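(* The interval reparametrization categories $\mathcal{G}$ and $\mathcal{M}$ have cuts, i.e. each of them admits a cut structure.
   Context: $\mathrm{Top}$ denotes either the category of $\Delta$-generated spaces (spaces whose topology is final with respect to all continuous maps from standard topological simplices) or its full subcategory of $\Delta$-Hausdorff ones (those for which the image of every continuous map $[0,1]\to X$ is closed). In either case $\mathrm{Top}$ is complete, cocomplete and cartesian closed. A reparametrization category $(\mathcal{P},\otimes)$ is a small $\mathrm{Top}$-enriched semimonoidal category (an enriched bifunctor $\otimes$, associative, with no unit required) such that: (1) the semimonoidal structure is strict (so $\otimes$ makes $\mathrm{Obj}(\mathcal{P})$ a semigroup); (2) every hom-space $\mathcal{P}(\ell,\ell')$ is contractible; (3) if $\phi:\ell\to\ell'$ and $\ell'=\ell'_1\otimes\ell'_2$, there are objects $\ell_1,\ell_2$ and maps $\phi_i:\ell_i\to\ell'_i$ with $\ell=\ell_1\otimes\ell_2$ and $\phi=\phi_1\otimes\phi_2$. A cut structure on $\mathcal{P}$ consists of: for every object $L$ a map $\delta_L:L\to L\otimes L$ (not required to be natural); for all objects $L,a,b$ continuous maps $c_1^{a,b}:\mathcal{P}(L,a\otimes b)\to\mathcal{P}(L,a)$ and $c_2^{a,b}:\mathcal{P}(L,a\otimes b)\to\mathcal{P}(L,b)$ such that for all $\alpha:a\to a'$, $\beta:b\to b'$, $\psi:L\to a\otimes b$ one has $c_1^{a',b'}((\alpha\otimes\beta)\psi)=\alpha c_1^{a,b}(\psi)$ and $c_2^{a',b'}((\alpha\otimes\beta)\psi)=\beta c_2^{a,b}(\psi)$;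 and, putting $N_L^{a,b}(\psi)=(c_1^{a,b}(\psi)\otimes c_2^{a,b}(\psi))\delta_L$, continuous maps $\Theta_L^{a,b}:[0,1]\times\mathcal{P}(L,a\otimes b)\to\mathcal{P}(L,a\otimes b)$ with $\Theta_L^{a,b}(0,\psi)=\psi$, $\Theta_L^{a,b}(1,\psi)=N_L^{a,b}(\psi)$ and $\Theta_L^{a',b'}(u,(\alpha\otimes\beta)\psi)=(\alpha\otimes\beta)\Theta_L^{a,b}(u,\psi)$. A reparametrization category has cuts if it admits a cut structure. The objects of $\mathcal{G}$ and $\mathcal{M}$ are the positive real numbers, with $a\otimes b=a+b$. The hom-spaces are $\mathcal{G}(a,b)=\{\text{nondecreasing homeomorphisms }[0,a]\to[0,b]\}$ and $\mathcal{M}(a,b)=\{\text{nondecreasing continuous surjections }[0,a]\to[0,b]\}$, each with the $\Delta$-kelleyfication of the relative compact-open topology (the $\Delta$-kelleyfication of a topology being the final topology with respect to all maps from standard topological simplices that are continuous for that topology); composition is composition of maps. For $\alpha:a\to a'$ and $\beta:b\to b'$, the map $\alpha\otimes\beta:[0,a+b]\to[0,a'+b']$ is $(\alpha\otimes\beta)(t)=\alpha(t)$ for $0\leq t\leq a$ and $(\alpha\otimes\beta)(t)=a'+\beta(t-a)$ for $a\leq t\leq a+b$. It is known that these are reparametrization categories. *)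

theory Defs
  imports "HOL-Analysis.Analysis" "HOL-Homology.Homology"
begin

section \<open>Delta-generated spaces\<close>

abbreviation simplex_topology :: "nat \<Rightarrow> (nat \<Rightarrow> real) topology" where
  "simplex_topology n \<equiv> subtopology (powertop_real UNIV) (standard_simplex n)"

definition delta_kelleyfication :: "'a topology \<Rightarrow> 'a topology" where
  "delta_kelleyfication X = topology (\<lambda>U. U \<subseteq> topspace X \<and>
     (\<forall>n f. continuous_map (simplex_topology n) X f \<longrightarrow>
        openin (simplex_topology n) {x \<in> standard_simplex n. f x \<in> U}))"

lemma openin_delta_kelleyfication:
  "openin (delta_kelleyfication X) U \<longleftrightarrow> U \<subseteq> topspace X \<and>
     (\<forall>n f. continuous_map (simplex_topology n) X f \<longrightarrow>
        openin (simplex_topology n) {x \<in> standard_simplex n. f x \<in> U})"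
proof -
  have "istopology (\<lambda>U. U \<subseteq> topspace X \<and>
     (\<forall>n f. continuous_map (simplex_topology n) X f \<longrightarrow>
        openin (simplex_topology n) {x \<in> standard_simplex n. f x \<in> U}))"
    (is "istopology ?L")
    unfolding istopology_def
  proof (intro conjI allI impI)
    fix S T n and f :: "(nat \<Rightarrow> real) \<Rightarrow> 'a"
    assume S: "?L S" and T: "?L T"
    show "S \<inter> T \<subseteq> topspace X"
      using S by blast
    assume f: "continuous_map (simplex_topology n) X f"
    have "{x \<in> standard_simplex n. f x \<in> S \<inter> T} =
        {x \<in> standard_simplex n. f x \<in> S} \<inter> {x \<in> standard_simplex n. f x \<in> T}"
      by blast
    then show "openin (simplex_topology n) {x \<in> standard_simplex n. f x \<in> S \<inter> T}"
      using S T f by (metis (no_types, lifting) openin_Int)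
  next
    fix \<K> :: "'a set set" and n and f :: "(nat \<Rightarrow> real) \<Rightarrow> 'a"
    assume K: "\<forall>K\<in>\<K>. ?L K"
    show "\<Union>\<K> \<subseteq> topspace X"
      using K by blast
    assume f: "continuous_map (simplex_topology n) X f"
    have "{x \<in> standard_simplex n. f x \<in> \<Union>\<K>} = (\<Union>K\<in>\<K>. {x \<in> standard_simplex n. f x \<in> K})"
      by blast
    moreover have "openin (simplex_topology n) (\<Union>K\<in>\<K>. {x \<in> standard_simplex n. f x \<in> K})"
      using K f by (intro openin_Union) blast
    ultimately show "openin (simplex_topology n) {x \<in> standard_simplex n. f x \<in> \<Union>\<K>}"
      by simp
  qed
  then show ?thesis
    unfolding delta_kelleyfication_def by simp
qed

definition delta_generated :: "'a topology \<Rightarrow> bool" where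
  "delta_generated X \<longleftrightarrow> delta_kelleyfication X = X"

definition delta_Hausdorff :: "'a topology \<Rightarrow> bool" where
  "delta_Hausdorff X \<longleftrightarrow>
     (\<forall>f. continuous_map (top_of_set {0..1::real}) X f \<longrightarrow> closedin X (f ` {0..1}))"

text \<open>The binary product of the category of \<open>\<Delta>\<close>-generated spaces. It is also the product in the
  full subcategory of \<open>\<Delta>\<close>-Hausdorff spaces.\<close>

definition Top_prod :: "'a topology \<Rightarrow> 'b topology \<Rightarrow> ('a \<times> 'b) topology" where
  "Top_prod X Y = delta_kelleyfication (prod_topology X Y)"


section \<open>Reparametrization categories\<close>

text \<open>Hom-spaces for different pairs of objects may overlap, so composition and the tensor product
  of morphisms take the objects involved as arguments: \<open>Comp P a b c g f\<close> is the composite of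
  \<open>f : a \<rightarrow> b\<close> and \<open>g : b \<rightarrow> c\<close>, and \<open>Tmor P a a' b b' f g\<close> is the tensor product of
  \<open>f : a \<rightarrow> a'\<close> and \<open>g : b \<rightarrow> b'\<close>.\<close>

record ('o, 'm) semimonoidal_data =
  Obj :: "'o set"
  Hom :: "'o \<Rightarrow> 'o \<Rightarrow> 'm topology"
  Comp :: "'o \<Rightarrow> 'o \<Rightarrow> 'o \<Rightarrow> 'm \<Rightarrow> 'm \<Rightarrow> 'm"
  Ident :: "'o \<Rightarrow> 'm"
  Tobj :: "'o \<Rightarrow> 'o \<Rightarrow> 'o"
  Tmor :: "'o \<Rightarrow> 'o \<Rightarrow> 'o \<Rightarrow> 'o \<Rightarrow> 'm \<Rightarrow> 'm \<Rightarrow> 'm"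

text \<open>The predicate \<open>Top\<close> says which spaces are allowed as hom-spaces; it is meant to be
  \<^const>\<open>delta_generated\<close> or its conjunction with \<^const>\<open>delta_Hausdorff\<close>.\<close>

locale Top_enriched_category =
  fixes Top :: "'m topology \<Rightarrow> bool"
    and P :: "('o, 'm) semimonoidal_data"
  assumes Hom_Top: "\<lbrakk>a \<in> Obj P; b \<in> Obj P\<rbrakk> \<Longrightarrow> Top (Hom P a b)"
    and Comp_continuous: "\<lbrakk>a \<in> Obj P; b \<in> Obj P; c \<in> Obj P\<rbrakk> \<Longrightarrow>
      continuous_map (Top_prod (Hom P b c) (Hom P a b)) (Hom P a c) (\<lambda>(g, f). Comp P a b c g f)"
    and Ident_in_Hom: "a \<in> Obj P \<Longrightarrow> Ident P a \<in> topspace (Hom P a a)"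
    and Comp_assoc: "\<lbrakk>a \<in> Obj P; b \<in> Obj P; c \<in> Obj P; d \<in> Obj P;
        f \<in> topspace (Hom P a b); g \<in> topspace (Hom P b c); h \<in> topspace (Hom P c d)\<rbrakk> \<Longrightarrow>
      Comp P a b d (Comp P b c d h g) f = Comp P a c d h (Comp P a b c g f)"
    and Comp_Ident_left: "\<lbrakk>a \<in> Obj P; b \<in> Obj P; f \<in> topspace (Hom P a b)\<rbrakk> \<Longrightarrow>
      Comp P a b b (Ident P b) f = f"
    and Comp_Ident_right: "\<lbrakk>a \<in> Obj P; b \<in> Obj P; f \<in> topspace (Hom P a b)\<rbrakk> \<Longrightarrow>
      Comp P a a b f (Ident P a) = f"

locale strict_semimonoidal_category = Top_enriched_category Top P
  for Top :: "'m topology \<Rightarrow> bool" and P :: "('o, 'm) semimonoidal_data" +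
  assumes Tobj_in_Obj: "\<lbrakk>a \<in> Obj P; b \<in> Obj P\<rbrakk> \<Longrightarrow> Tobj P a b \<in> Obj P"
    and Tmor_continuous: "\<lbrakk>a \<in> Obj P; a' \<in> Obj P; b \<in> Obj P; b' \<in> Obj P\<rbrakk> \<Longrightarrow>
      continuous_map (Top_prod (Hom P a a') (Hom P b b')) (Hom P (Tobj P a b) (Tobj P a' b'))
        (\<lambda>(f, g). Tmor P a a' b b' f g)"
    and Tmor_Ident: "\<lbrakk>a \<in> Obj P; b \<in> Obj P\<rbrakk> \<Longrightarrow>
      Tmor P a a b b (Ident P a) (Ident P b) = Ident P (Tobj P a b)"
    and Tmor_Comp: "\<lbrakk>a \<in> Obj P; a' \<in> Obj P; a'' \<in> Obj P; b \<in> Obj P; b' \<in> Obj P; b'' \<in> Obj P;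
        f \<in> topspace (Hom P a a'); f' \<in> topspace (Hom P a' a'');
        g \<in> topspace (Hom P b b'); g' \<in> topspace (Hom P b' b'')\<rbrakk> \<Longrightarrow>
      Tmor P a a'' b b'' (Comp P a a' a'' f' f) (Comp P b b' b'' g' g) =
      Comp P (Tobj P a b) (Tobj P a' b') (Tobj P a'' b'')
        (Tmor P a' a'' b' b'' f' g') (Tmor P a a' b b' f g)"
    and Tobj_assoc: "\<lbrakk>a \<in> Obj P; b \<in> Obj P; c \<in> Obj P\<rbrakk> \<Longrightarrow>
      Tobj P (Tobj P a b) c = Tobj P a (Tobj P b c)"
    and Tmor_assoc: "\<lbrakk>a \<in> Obj P; a' \<in> Obj P; b \<in> Obj P; b' \<in> Obj P; c \<in> Obj P; c' \<in> Obj P;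
        f \<in> topspace (Hom P a a'); g \<in> topspace (Hom P b b'); h \<in> topspace (Hom P c c')\<rbrakk> \<Longrightarrow>
      Tmor P (Tobj P a b) (Tobj P a' b') c c' (Tmor P a a' b b' f g) h =
      Tmor P a a' (Tobj P b c) (Tobj P b' c') f (Tmor P b b' c c' g h)"

text \<open>\<^const>\<open>contractible_space\<close> holds for the empty space, hence the separate nonemptiness
  assumption. It uses the ordinary product with the unit interval, which for a
  \<open>\<Delta>\<close>-generated space agrees with \<^const>\<open>Top_prod\<close> because the interval is locally compact.\<close>

locale reparametrization_category = strict_semimonoidal_category Top P
  for Top :: "'m topology \<Rightarrow> bool" and P :: "('o, 'm) semimonoidal_data" +
  assumes Hom_nonempty: "\<lbrakk>a \<in> Obj P; b \<in> Obj P\<rbrakk> \<Longrightarrow> topspace (Hom P a b) \<noteq> {}"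
    and Hom_contractible: "\<lbrakk>a \<in> Obj P; b \<in> Obj P\<rbrakk> \<Longrightarrow> contractible_space (Hom P a b)"
    and Tmor_decompose: "\<lbrakk>l \<in> Obj P; l1' \<in> Obj P; l2' \<in> Obj P; \<phi> \<in> topspace (Hom P l (Tobj P l1' l2'))\<rbrakk> \<Longrightarrow>
      \<exists>l1\<in>Obj P. \<exists>l2\<in>Obj P. \<exists>\<phi>1\<in>topspace (Hom P l1 l1'). \<exists>\<phi>2\<in>topspace (Hom P l2 l2').
        l = Tobj P l1 l2 \<and> \<phi> = Tmor P l1 l1' l2 l2' \<phi>1 \<phi>2"


section \<open>Cuts\<close>

locale cut_structure = reparametrization_category Top P
  for Top :: "'m topology \<Rightarrow> bool" and P :: "('o, 'm) semimonoidal_data" +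
  fixes \<delta> :: "'o \<Rightarrow> 'm"
    and c1 c2 :: "'o \<Rightarrow> 'o \<Rightarrow> 'o \<Rightarrow> 'm \<Rightarrow> 'm"
    and \<Theta> :: "'o \<Rightarrow> 'o \<Rightarrow> 'o \<Rightarrow> real \<times> 'm \<Rightarrow> 'm"
  assumes \<delta>_in_Hom: "L \<in> Obj P \<Longrightarrow> \<delta> L \<in> topspace (Hom P L (Tobj P L L))"
    and c1_continuous: "\<lbrakk>L \<in> Obj P; a \<in> Obj P; b \<in> Obj P\<rbrakk> \<Longrightarrow>
      continuous_map (Hom P L (Tobj P a b)) (Hom P L a) (c1 L a b)"
    and c2_continuous: "\<lbrakk>L \<in> Obj P; a \<in> Obj P; b \<in> Obj P\<rbrakk> \<Longrightarrow>
      continuous_map (Hom P L (Tobj P a b)) (Hom P L b) (c2 L a b)"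
    and c1_natural: "\<lbrakk>L \<in> Obj P; a \<in> Obj P; a' \<in> Obj P; b \<in> Obj P; b' \<in> Obj P;
        \<alpha> \<in> topspace (Hom P a a'); \<beta> \<in> topspace (Hom P b b'); \<psi> \<in> topspace (Hom P L (Tobj P a b))\<rbrakk> \<Longrightarrow>
      c1 L a' b' (Comp P L (Tobj P a b) (Tobj P a' b') (Tmor P a a' b b' \<alpha> \<beta>) \<psi>) =
      Comp P L a a' \<alpha> (c1 L a b \<psi>)"
    and c2_natural: "\<lbrakk>L \<in> Obj P; a \<in> Obj P; a' \<in> Obj P; b \<in> Obj P; b' \<in> Obj P;
        \<alpha> \<in> topspace (Hom P a a'); \<beta> \<in> topspace (Hom P b b'); \<psi> \<in> topspace (Hom P L (Tobj P a b))\<rbrakk> \<Longrightarrow>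
      c2 L a' b' (Comp P L (Tobj P a b) (Tobj P a' b') (Tmor P a a' b b' \<alpha> \<beta>) \<psi>) =
      Comp P L b b' \<beta> (c2 L a b \<psi>)"
    and \<Theta>_continuous: "\<lbrakk>L \<in> Obj P; a \<in> Obj P; b \<in> Obj P\<rbrakk> \<Longrightarrow>
      continuous_map (Top_prod (top_of_set {0..1}) (Hom P L (Tobj P a b))) (Hom P L (Tobj P a b)) (\<Theta> L a b)"
    and \<Theta>_0: "\<lbrakk>L \<in> Obj P; a \<in> Obj P; b \<in> Obj P; \<psi> \<in> topspace (Hom P L (Tobj P a b))\<rbrakk> \<Longrightarrow>
      \<Theta> L a b (0, \<psi>) = \<psi>"
    and \<Theta>_1: "\<lbrakk>L \<in> Obj P; a \<in> Obj P; b \<in> Obj P; \<psi> \<in> topspace (Hom P L (Tobj P a b))\<rbrakk> \<Longrightarrow>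
      \<Theta> L a b (1, \<psi>) =
      Comp P L (Tobj P L L) (Tobj P a b) (Tmor P L a L b (c1 L a b \<psi>) (c2 L a b \<psi>)) (\<delta> L)"
    and \<Theta>_natural: "\<lbrakk>L \<in> Obj P; a \<in> Obj P; a' \<in> Obj P; b \<in> Obj P; b' \<in> Obj P;
        \<alpha> \<in> topspace (Hom P a a'); \<beta> \<in> topspace (Hom P b b'); \<psi> \<in> topspace (Hom P L (Tobj P a b));
        u \<in> {0..1}\<rbrakk> \<Longrightarrow>
      \<Theta> L a' b' (u, Comp P L (Tobj P a b) (Tobj P a' b') (Tmor P a a' b b' \<alpha> \<beta>) \<psi>) =
      Comp P L (Tobj P a b) (Tobj P a' b') (Tmor P a a' b b' \<alpha> \<beta>) (\<Theta> L a b (u, \<psi>))"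

text \<open>The locale predicate includes that \<open>P\<close> is a reparametrization category.\<close>

definition has_cuts :: "('m topology \<Rightarrow> bool) \<Rightarrow> ('o, 'm) semimonoidal_data \<Rightarrow> bool" where
  "has_cuts Top P \<longleftrightarrow> (\<exists>\<delta> c1 c2 \<Theta>. cut_structure Top P \<delta> c1 c2 \<Theta>)"


section \<open>The interval reparametrization categories\<close>

text \<open>Maps are made extensional, so that equality of functions is equality of maps on the
  topological space \<open>X\<close>.\<close>

definition compact_open_topology :: "'a topology \<Rightarrow> 'b topology \<Rightarrow> ('a \<Rightarrow> 'b) topology" where
  "compact_open_topology X Y = topology_generated_by
     {{f \<in> extensional (topspace X). continuous_map X Y f \<and> f ` K \<subseteq> U} | K U.
        compactin X K \<and> openin Y U}"

definition G_maps :: "real \<Rightarrow> real \<Rightarrow> (real \<Rightarrow> real) set" where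
  "G_maps a b = {f \<in> extensional {0..a}.
     homeomorphic_map (top_of_set {0..a}) (top_of_set {0..b}) f \<and> mono_on {0..a} f}"

definition M_maps :: "real \<Rightarrow> real \<Rightarrow> (real \<Rightarrow> real) set" where
  "M_maps a b = {f \<in> extensional {0..a}.
     continuous_map (top_of_set {0..a}) (top_of_set {0..b}) f \<and> f ` {0..a} = {0..b} \<and>
     mono_on {0..a} f}"

definition interval_category ::
    "(real \<Rightarrow> real \<Rightarrow> (real \<Rightarrow> real) set) \<Rightarrow> (real, real \<Rightarrow> real) semimonoidal_data" where
  "interval_category H = \<lparr>
     Obj = {0<..},
     Hom = (\<lambda>a b. delta_kelleyfication
       (subtopology (compact_open_topology (top_of_set {0..a}) (top_of_set {0..b})) (H a b))),
     Comp = (\<lambda>a b c g f. compose {0..a} g f),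
     Ident = (\<lambda>a. \<lambda>t\<in>{0..a}. t),
     Tobj = (+),
     Tmor = (\<lambda>a a' b b' \<alpha> \<beta>. \<lambda>t\<in>{0..a + b}. if t \<le> a then \<alpha> t else a' + \<beta> (t - a))\<rparr>"

definition \<G> :: "(real, real \<Rightarrow> real) semimonoidal_data" where
  "\<G> = interval_category G_maps"

definition \<M> :: "(real, real \<Rightarrow> real) semimonoidal_data" where
  "\<M> = interval_category M_maps"

end

theory Submission
  imports Defs
begin

text \<open>
  A cut structure has to split a map \<open>\<psi> : L \<rightarrow> a \<otimes> b\<close> into a map to \<open>a\<close> and a map to \<open>b\<close>, both with the
  same source \<open>L\<close>, compatibly with postcomposition by \<open>\<alpha> \<otimes> \<beta>\<close>. In both categories \<open>\<delta>\<close> is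
  \<open>t \<mapsto> 2 t\<close>, but the splitting differs.

  In \<open>\<M>\<close> a time at which \<open>\<psi>\<close> passes through \<open>a\<close> cannot be used: \<open>\<psi>\<close> may stay at \<open>a\<close> on an
  interval, which postcomposition with \<open>\<alpha> \<otimes> \<beta>\<close> enlarges arbitrarily on either side, so no choice of a time in it
  is natural. Clipping the values avoids any choice: \<open>min (\<psi> t) a\<close> and \<open>max (\<psi> t) a - a\<close> are natural,
  because \<open>\<alpha> \<otimes> \<beta>\<close> preserves the cutting level. The normal form \<open>N(\<psi>)\<close> runs through the first
  clipped map at double speed and then through the second one; the homotopy accelerates the first one and
  delays the second one gradually. Its value is \<open>min (\<psi> p) a + (max (\<psi> q) a - a)\<close> with times
  \<open>q \<le> p\<close>, so at any moment the first summand has already reached \<open>a\<close> or the second one is still \<open>0\<close>, and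
  on such sums \<open>\<alpha> \<otimes> \<beta>\<close> acts summandwise (\<open>tensor_add\<close>, \<open>clip_path_natural\<close>).

  Clipped maps are not injective, so \<open>\<G>\<close> needs the other construction, which there is available: the
  time \<open>s\<close> with \<open>\<psi> s = a\<close> is unique and does not change under postcomposition with \<open>\<alpha> \<otimes> \<beta>\<close>
  (\<open>crossing_natural\<close>). The two parts of \<open>\<psi>\<close> before and after \<open>s\<close> are rescaled to \<open>[0, L]\<close>,
  and \<open>N(\<psi>)\<close> is \<open>\<psi>\<close> precomposed with the piecewise affine homeomorphism of \<open>[0, L]\<close> that sends
  \<open>L / 2\<close> to \<open>s\<close>. The homotopy is the straight line from the identity to this homeomorphism.

  For the topology, a space whose topology is final for maps from simplices makes continuity testable on
  simplices, and by the exponential law for the compact-open topology a map from a simplex to a hom-space is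
  continuous iff the corresponding function of two variables is
  (\<open>continuous_map_simplex_into_Hom\<close>). All continuity conditions thus become statements about
  families of monotone functions that depend continuously on parameters. The one exception is
  contractibility of the hom-spaces, which refers to the ordinary product with \<open>[0, 1]\<close>; that product is
  already \<open>\<Delta>\<close>-generated (\<open>delta_generated_interval_product\<close>).
\<close>

section \<open>Simplices as test spaces\<close>

text \<open>Rewriting to the topology of a type class makes \<^const>\<open>continuous_on\<close> and its rules applicable
  to simplices.\<close>
lemma simplex_topology_eq: "simplex_topology n = top_of_set (standard_simplex n)"
  by (simp add: euclidean_product_topology)

lemma topspace_delta_kelleyfication [simp]: "topspace (delta_kelleyfication X) = topspace X"
proof -
  have "openin (delta_kelleyfication X) (topspace X)"
    unfolding openin_delta_kelleyfication
  proof (intro conjI allI impI)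
    fix n f assume "continuous_map (simplex_topology n) X f"
    then have "{x \<in> standard_simplex n. f x \<in> topspace X} = standard_simplex n"
      by (auto simp: continuous_map_def)
    then show "openin (simplex_topology n) {x \<in> standard_simplex n. f x \<in> topspace X}"
      by (metis openin_topspace topspace_standard_simplex)
  qed simp
  moreover have "topspace (delta_kelleyfication X) \<subseteq> topspace X"
    using openin_delta_kelleyfication[of X "topspace (delta_kelleyfication X)"] by simp
  ultimately show ?thesis
    by (metis openin_subset subset_antisym)
qed

lemma openin_imp_openin_delta_kelleyfication:
  assumes "openin X U"
  shows "openin (delta_kelleyfication X) U"
  unfolding openin_delta_kelleyfication
proof (intro conjI allI impI)
  show "U \<subseteq> topspace X" using assms by (rule openin_subset)
  fix n f assume "continuous_map (simplex_topology n) X f"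
  then show "openin (simplex_topology n) {x \<in> standard_simplex n. f x \<in> U}"
    using openin_continuous_map_preimage[OF _ assms] by fastforce
qed

text \<open>The \<open>\<Delta>\<close>-kelleyfication does not create or destroy
  continuous maps from simplices; hence it is idempotent, and hom-spaces can be probed in the
  compact-open topology itself.\<close>
lemma continuous_map_simplex_into_delta_kelleyfication:
  "continuous_map (simplex_topology n) (delta_kelleyfication X) f \<longleftrightarrow>
     continuous_map (simplex_topology n) X f" (is "?l = ?r")
proof
  assume ?l
  then show ?r
    using openin_imp_openin_delta_kelleyfication[of X] by (auto simp: continuous_map_def)
next
  assume r: ?r
  then show ?l
    by (auto simp: continuous_map_def[of _ "delta_kelleyfication X"] openin_delta_kelleyfication
        Pi_iff
        dest!: continuous_map_funspace)
qed

lemma delta_generated_delta_kelleyfication: "delta_generated (delta_kelleyfication X)"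
  unfolding delta_generated_def
  by (intro topology_eq[THEN iffD2] allI)
     (simp add: openin_delta_kelleyfication continuous_map_simplex_into_delta_kelleyfication)

lemma continuous_map_from_delta_kelleyfication:
  assumes "\<And>n f. continuous_map (simplex_topology n) X f \<Longrightarrow>
    continuous_map (simplex_topology n) Y (h \<circ> f)"
  shows "continuous_map (delta_kelleyfication X) Y h"
  unfolding continuous_map_def
proof (intro conjI allI impI)
  show "h \<in> topspace (delta_kelleyfication X) \<rightarrow> topspace Y"
  proof
    fix x assume x: "x \<in> topspace (delta_kelleyfication X)"
    then have c: "continuous_map (simplex_topology 0) X (\<lambda>_. x)"
      by simp
    have "(\<lambda>_. h x) \<in> standard_simplex 0 \<rightarrow> topspace Y"
      using continuous_map_funspace[OF assms[OF c]] by (simp add: o_def)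
    then show "h x \<in> topspace Y"
      using nonempty_standard_simplex[of 0] by auto
  qed
next
  fix U assume U: "openin Y U"
  show "openin (delta_kelleyfication X) {x \<in> topspace (delta_kelleyfication X). h x \<in> U}"
    unfolding openin_delta_kelleyfication
  proof (intro conjI allI impI)
    fix n f assume f: "continuous_map (simplex_topology n) X f"
    have "{x \<in> standard_simplex n. f x \<in> {x \<in> topspace (delta_kelleyfication X). h x \<in> U}} =
        {x \<in> topspace (simplex_topology n). (h \<circ> f) x \<in> U}"
      using f by (auto simp: continuous_map_def)
    then show "openin (simplex_topology n)
        {x \<in> standard_simplex n. f x \<in> {x \<in> topspace (delta_kelleyfication X). h x \<in> U}}"
      using openin_continuous_map_preimage[OF assms[OF f] U] by simp
  qed auto
qed

lemma continuous_map_from_delta_generated: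
  assumes "delta_generated X"
    and "\<And>n f. continuous_map (simplex_topology n) X f \<Longrightarrow> continuous_map (simplex_topology n) Y (h \<circ> f)"
  shows "continuous_map X Y h"
  using continuous_map_from_delta_kelleyfication[of X Y h] assms by (simp add: delta_generated_def)

text \<open>A map from a simplex to the product is a pair of maps, so continuity on the product in the
  category of \<open>\<Delta>\<close>-generated spaces may be tested with two independent families.\<close>
lemma continuous_map_from_Top_prod:
  assumes "\<And>n f g. \<lbrakk>continuous_map (simplex_topology n) X f; continuous_map (simplex_topology n) Y g\<rbrakk>
    \<Longrightarrow> continuous_map (simplex_topology n) Z (\<lambda>z. h (f z, g z))"
  shows "continuous_map (Top_prod X Y) Z h"
  unfolding Top_prod_def
proof (rule continuous_map_from_delta_kelleyfication)
  fix n f assume "continuous_map (simplex_topology n) (prod_topology X Y) f"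
  then have "continuous_map (simplex_topology n) X (fst \<circ> f)"
    "continuous_map (simplex_topology n) Y (snd \<circ> f)"
    by (simp_all add: continuous_map_pairwise)
  from assms[OF this] show "continuous_map (simplex_topology n) Z (h \<circ> f)"
    by (simp add: o_def)
qed

text \<open>The tube lemma, in the form in which a compact set of conditions remains an open condition.\<close>
lemma openin_all_compact_fibres:
  assumes W: "openin (prod_topology X Y) W" and K: "compactin Y K"
  shows "openin X {x \<in> topspace X. \<forall>t\<in>K. (x, t) \<in> W}"
proof (subst openin_subopen, intro ballI)
  fix x assume x: "x \<in> {x \<in> topspace X. \<forall>t\<in>K. (x, t) \<in> W}"
  then have "compactin X {x}" "{x} \<times> K \<subseteq> W"
    by auto
  from Wallace_theorem_prod_topology[OF this(1) K W this(2)]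
  obtain U V where "openin X U" "openin Y V" "{x} \<subseteq> U" "K \<subseteq> V" "U \<times> V \<subseteq> W"
    by metis
  then show "\<exists>T. openin X T \<and> x \<in> T \<and> T \<subseteq> {x \<in> topspace X. \<forall>t\<in>K. (x, t) \<in> W}"
    by (intro exI[of _ U]) (use openin_subset in fastforce)
qed

text \<open>The definition of the \<open>\<Delta>\<close>-kelleyfication tests only with simplices, but the prism
  \<open>[0, 1] \<times> \<Delta>\<^sup>n\<close> is a retract of \<open>\<Delta>\<^sup>2\<^sup>n\<^sup>+\<^sup>1\<close>, so it can be used as a test space as
  well. The retraction \<open>r\<close> is the affine map that sends the vertices of the simplex bijectively to those of the prism: the
  first \<open>n + 1\<close> barycentric coordinates belong to the bottom of the prism and the others to the top.\<close>
lemma delta_kelleyfication_preimage_interval_times_simplex: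
  assumes W: "openin (delta_kelleyfication Y) W"
    and g: "continuous_map (prod_topology (top_of_set {0..1::real}) (simplex_topology n)) Y g"
  shows "openin (prod_topology (top_of_set {0..1}) (simplex_topology n))
    {p \<in> {0..1} \<times> standard_simplex n. g p \<in> W}"
proof -
  define N where "N = 2 * n + 1"
  define r :: "(nat \<Rightarrow> real) \<Rightarrow> real \<times> (nat \<Rightarrow> real)" where
    "r = (\<lambda>w. (\<Sum>i\<le>n. w (Suc n + i), \<lambda>i. if i \<le> n then w i + w (Suc n + i) else 0))"
  define \<sigma> :: "real \<times> (nat \<Rightarrow> real) \<Rightarrow> nat \<Rightarrow> real" where
    "\<sigma> = (\<lambda>p i. if i \<le> n then (1 - fst p) * snd p i
       else if i \<le> N then fst p * snd p (i - Suc n) else 0)"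
  have split: "(\<Sum>i\<le>N. w i) = (\<Sum>i\<le>n. w i) + (\<Sum>i\<le>n. w (Suc n + i))" for w :: "nat \<Rightarrow> real"
  proof -
    have "(\<Sum>i\<le>N. w i) = (\<Sum>i\<in>{0..n}. w i) + (\<Sum>i\<in>{Suc n..Suc n + n}. w i)"
      using sum.ub_add_nat[of 0 n w "Suc n"]
      by (simp add: N_def atLeast0AtMost mult_2)
    also have "(\<Sum>i\<in>{Suc n..Suc n + n}. w i) = (\<Sum>i\<le>n. w (Suc n + i))"
      using sum.shift_bounds_cl_nat_ivl[of w 0 "Suc n" n]
      by (simp add: atLeast0AtMost add.commute)
    finally show ?thesis by (simp add: atLeast0AtMost)
  qed
  have r_mem: "r w \<in> {0..1} \<times> standard_simplex n" if "w \<in> standard_simplex N" for w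
  proof -
    have w: "0 \<le> w i" for i
      using that by (auto simp: standard_simplex_def)
    have s: "(\<Sum>i\<le>n. w i) + (\<Sum>i\<le>n. w (Suc n + i)) = 1"
      using that split[of w] by (simp add: standard_simplex_def)
    have t: "(\<Sum>i\<le>n. w i + w (Suc n + i)) = 1"
      using s by (simp add: sum.distrib)
    have "w i + w (Suc n + i) \<le> 1" if "i \<le> n" for i
      using member_le_sum[of i "{..n}" "\<lambda>i. w i + w (Suc n + i)"] that w t by simp
    moreover have "0 \<le> (\<Sum>i\<le>n. w i)" "0 \<le> (\<Sum>i\<le>n. w (Suc n + i))"
      using w by (simp_all add: sum_nonneg)
    ultimately show ?thesis
      using s t w by (auto simp: r_def standard_simplex_def)
  qed
  have \<sigma>_mem: "\<sigma> p \<in> standard_simplex N" if p_mem: "p \<in> {0..1} \<times> standard_simplex n" for p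
  proof -
    obtain t z where p: "p = (t, z)" "0 \<le> t" "t \<le> 1" and "z \<in> standard_simplex n"
      using p_mem by (cases p) auto
    then have z: "\<And>i. 0 \<le> z i" "\<And>i. z i \<le> 1" "(\<Sum>i\<le>n. z i) = 1"
      by (auto simp: standard_simplex_def)
    have "(\<Sum>i\<le>N. \<sigma> p i) = (\<Sum>i\<le>n. (1 - t) * z i) + (\<Sum>i\<le>n. t * z i)"
      unfolding split by (simp add: \<sigma>_def p N_def)
    also have "\<dots> = (1 - t) * (\<Sum>i\<le>n. z i) + t * (\<Sum>i\<le>n. z i)"
      by (simp add: sum_distrib_left)
    also have "\<dots> = 1"
      using z by simp
    finally show ?thesis
      using p z by (auto simp: standard_simplex_def \<sigma>_def N_def intro!: mult_le_one)
  qed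
  have r\<sigma>: "r (\<sigma> p) = p" if p_mem: "p \<in> {0..1} \<times> standard_simplex n" for p
  proof -
    obtain t z where p: "p = (t, z)" and "z \<in> standard_simplex n"
      using p_mem by (cases p) auto
    then have z: "(\<Sum>i\<le>n. z i) = 1" "\<And>i. i > n \<Longrightarrow> z i = 0"
      by (auto simp: standard_simplex_def)
    have "(\<Sum>i\<le>n. \<sigma> p (Suc n + i)) = (\<Sum>i\<le>n. t * z i)"
      by (simp add: \<sigma>_def p N_def)
    also have "\<dots> = t" using z(1) by (simp flip: sum_distrib_left)
    finally have "fst (r (\<sigma> p)) = t"
      by (simp add: r_def)
    moreover have "snd (r (\<sigma> p)) i = z i" for i
      using z(2)[of i] by (simp add: r_def \<sigma>_def p N_def algebra_simps)
    ultimately show ?thesis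
      by (simp add: p prod_eq_iff fun_eq_iff)
  qed
  have "continuous_on UNIV r"
  proof -
    have "continuous_on UNIV (\<lambda>w::nat \<Rightarrow> real. if i \<le> n then w i + w (Suc n + i) else 0)" for i
      by (cases "i \<le> n") (simp_all add: continuous_on_add continuous_on_product_coordinates)
    then show ?thesis
      unfolding r_def
      by (intro continuous_on_Pair continuous_on_sum continuous_on_product_coordinates
          continuous_on_coordinatewise_then_product)
  qed
  then have "continuous_map (simplex_topology N)
      (prod_topology (top_of_set {0..1}) (simplex_topology n)) r"
    using r_mem continuous_on_subset
    by (fastforce simp: simplex_topology_eq)
  from continuous_map_compose[OF this g]
  have gr: "continuous_map (simplex_topology N) Y (g \<circ> r)" .
  have "continuous_on UNIV \<sigma>"
  proof (rule continuous_on_coordinatewise_then_product)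
    have c: "continuous_on UNIV (\<lambda>p::real \<times> (nat \<Rightarrow> real). snd p i)" for i
      by (rule continuous_on_compose2[OF continuous_on_product_coordinates continuous_on_snd]) auto
    show "continuous_on UNIV (\<lambda>p. \<sigma> p i)" for i
      unfolding \<sigma>_def
      by (cases "i \<le> n"; cases "i \<le> N") (simp_all add: c continuous_on_mult continuous_on_diff continuous_on_fst)
  qed
  then have c\<sigma>: "continuous_map (prod_topology (top_of_set {0..1}) (simplex_topology n))
      (simplex_topology N) \<sigma>"
    using \<sigma>_mem continuous_on_subset by (fastforce simp: simplex_topology_eq)
  have "openin (simplex_topology N) {w \<in> standard_simplex N. (g \<circ> r) w \<in> W}"
    using W gr unfolding openin_delta_kelleyfication by blast
  from openin_continuous_map_preimage[OF c\<sigma> this]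
  show ?thesis
    by (rule back_subst[of "openin _"]) (use \<sigma>_mem r\<sigma> in auto)
qed

text \<open>This holds because the interval is locally compact. Around a point of a set \<open>W\<close> that is open for the
  \<open>\<Delta>\<close>-kelleyfication of the product, choose a compact neighbourhood \<open>J\<close> of the time coordinate in the slice of
  \<open>W\<close>; the points \<open>x\<close> with \<open>J \<times> {x} \<subseteq> W\<close> form an open set since the tube lemma applies to the
  preimage of \<open>W\<close> under each map from a prism.\<close>
lemma delta_generated_interval_product:
  assumes X: "delta_generated X"
  shows "delta_generated (prod_topology (top_of_set {0..1::real}) X)"
proof -
  let ?I = "top_of_set {0..1::real}"
  have "openin (prod_topology ?I X) W" if W: "openin (delta_kelleyfication (prod_topology ?I X)) W" for W
    unfolding openin_prod_topology_alt
  proof (intro allI impI)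
    fix t0 x0 assume m: "(t0, x0) \<in> W"
    have "W \<subseteq> {0..1} \<times> topspace X"
      using W by (simp add: openin_delta_kelleyfication)
    with m have t0: "t0 \<in> {0..1}" and x0: "x0 \<in> topspace X"
      by auto
    have pre: "openin (prod_topology ?I (simplex_topology n)) {p \<in> {0..1} \<times> standard_simplex n. (fst p, f (snd p)) \<in> W}"
      if f: "continuous_map (simplex_topology n) X f" for n f
    proof (rule delta_kelleyfication_preimage_interval_times_simplex[OF W])
      show "continuous_map (prod_topology ?I (simplex_topology n)) (prod_topology ?I X)
          (\<lambda>p. (fst p, f (snd p)))"
        using continuous_map_compose[OF continuous_map_snd f]
        by (auto simp: continuous_map_pairwise o_def continuous_map_fst)
    qed
    \<comment> \<open>The slice of \<open>W\<close> at \<open>x0\<close> is open by the prism test for the constant map from a point.\<close>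
    obtain z0 where z0: "z0 \<in> standard_simplex 0"
      using nonempty_standard_simplex by blast
    have "continuous_map ?I (prod_topology ?I (simplex_topology 0)) (\<lambda>t. (t, z0))"
      using z0 by (simp add: continuous_map_pairwise o_def del: prod_topology_subtopology_eu)
    from openin_continuous_map_preimage[OF this pre[of 0 "\<lambda>_. x0"]] x0
    have "openin ?I {t \<in> {0..1}. (t, z0) \<in> {p \<in> {0..1} \<times> standard_simplex 0. (fst p, x0) \<in> W}}"
      by simp
    then have "openin ?I {t \<in> {0..1}. (t, x0) \<in> W}"
      by (rule back_subst[of "openin _"]) (use z0 in auto)
    then obtain e where e: "e > 0" "\<And>t. t \<in> {0..1} \<Longrightarrow> dist t t0 < e \<Longrightarrow> (t, x0) \<in> W"
      using m t0 by (auto simp: openin_euclidean_subtopology_iff)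
    define J where "J = {0..1} \<inter> cball t0 (e/2)"
    have J: "compactin ?I J"
      by (simp add: J_def compactin_subtopology compact_Int_closed)
    define V where "V = {x \<in> topspace X. \<forall>t\<in>J. (t, x) \<in> W}"
    have "openin (delta_kelleyfication X) V"
      unfolding openin_delta_kelleyfication
    proof (intro conjI allI impI)
      fix n f assume f: "continuous_map (simplex_topology n) X f"
      have "continuous_map (prod_topology (simplex_topology n) ?I)
          (prod_topology ?I (simplex_topology n)) prod.swap"
        by (rule continuous_map_pairwise[THEN iffD2]) (simp add: o_def continuous_map_fst continuous_map_snd)
      from openin_continuous_map_preimage[OF this pre[OF f]]
      have "openin (prod_topology (simplex_topology n) ?I)
          {p \<in> standard_simplex n \<times> {0..1}. (snd p, f (fst p)) \<in> W}" 
        by (rule back_subst[of "openin _"]) auto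
      from openin_all_compact_fibres[OF this J]
      show "openin (simplex_topology n) {x \<in> standard_simplex n. f x \<in> V}"
        by (rule back_subst[of "openin _"])
           (use continuous_map_funspace[OF f] in \<open>auto simp: V_def J_def\<close>)
    qed (auto simp: V_def)
    then have V: "openin X V"
      using X by (simp add: delta_generated_def)
    show "\<exists>U V. openin ?I U \<and> openin X V \<and> t0 \<in> U \<and> x0 \<in> V \<and> U \<times> V \<subseteq> W"
    proof (intro exI conjI)
      show "openin ?I ({0..1} \<inter> ball t0 (e/2))" by (simp add: openin_open_Int)
      show "openin X V" by (rule V)
      show "t0 \<in> {0..1} \<inter> ball t0 (e/2)" using t0 e by simp
      show "x0 \<in> V" using x0 e by (auto simp: V_def J_def dist_commute)
      show "({0..1} \<inter> ball t0 (e/2)) \<times> V \<subseteq> W" by (auto simp: V_def J_def)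
    qed
  qed
  then show ?thesis
    unfolding delta_generated_def topology_eq
    using openin_imp_openin_delta_kelleyfication by blast
qed

text \<open>The \<open>\<Delta>\<close>-kelleyfication refines the topology, so it is again Hausdorff, and then images of paths are
  compact and therefore closed.\<close>
lemma delta_Hausdorff_delta_kelleyfication:
  assumes "Hausdorff_space X"
  shows "delta_Hausdorff (delta_kelleyfication X)"
proof -
  have "Hausdorff_space (delta_kelleyfication X)"
    unfolding Hausdorff_space_def topspace_delta_kelleyfication
    by (metis assms Hausdorff_space_def openin_imp_openin_delta_kelleyfication)
  then show ?thesis
    unfolding delta_Hausdorff_def
    by (metis compactin_imp_closedin image_compactin compactin_absolute compact_Icc
        compactin_euclidean_iff)
qed


section \<open>The compact-open topology\<close>

lemma topspace_compact_open_topology: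
  "topspace (compact_open_topology X Y) = {f \<in> extensional (topspace X). continuous_map X Y f}"
proof -
  have "compactin X {}" "openin Y {}" by auto
  then show ?thesis
    unfolding compact_open_topology_def topology_generated_by_topspace by blast
qed

text \<open>The exponential law for the compact-open topology. Continuity of the curried map follows from the tube lemma;
  conversely, evaluation near \<open>(z, x)\<close> is controlled by the subbasic set given by a compact neighbourhood of
  \<open>x\<close>.\<close>
lemma continuous_map_into_compact_open_topology:
  assumes X: "neighbourhood_base_of (compactin X) X"
    and f: "\<And>z. z \<in> topspace Z \<Longrightarrow> f z \<in> extensional (topspace X) \<and> continuous_map X Y (f z)"
  shows "continuous_map Z (compact_open_topology X Y) f \<longleftrightarrow>
    continuous_map (prod_topology Z X) Y (\<lambda>(z, x). f z x)" (is "?l = ?r")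
proof
  assume r: ?r
  show ?l
    unfolding compact_open_topology_def
  proof (rule continuous_on_generated_topo)
    fix S assume "S \<in> {{f \<in> extensional (topspace X). continuous_map X Y f \<and> f ` K \<subseteq> U} | K U.
        compactin X K \<and> openin Y U}"
    then obtain K U where S: "S = {f \<in> extensional (topspace X). continuous_map X Y f \<and> f ` K \<subseteq> U}"
      and K: "compactin X K" and U: "openin Y U"
      by blast
    have "openin (prod_topology Z X) {p \<in> topspace (prod_topology Z X). (\<lambda>(z, x). f z x) p \<in> U}"
      using r U by (rule openin_continuous_map_preimage)
    from openin_all_compact_fibres[OF this K]
    show "openin Z (f -` S \<inter> topspace Z)"
      by (rule back_subst[of "openin _"])
         (use f compactin_subset_topspace[OF K] in \<open>auto simp: S image_subset_iff\<close>)
  next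
    show "f ` topspace Z \<subseteq> \<Union>{{f \<in> extensional (topspace X). continuous_map X Y f \<and> f ` K \<subseteq> U} | K U.
        compactin X K \<and> openin Y U}"
      using topspace_compact_open_topology[of X Y] f
      unfolding compact_open_topology_def topology_generated_by_topspace by blast
  qed
next
  assume l: ?l
  show ?r
    unfolding continuous_map_def
  proof (intro conjI allI impI)
    show "(\<lambda>(z, x). f z x) \<in> topspace (prod_topology Z X) \<rightarrow> topspace Y"
      using f by (fastforce simp: continuous_map_def)
    fix U assume U: "openin Y U"
    show "openin (prod_topology Z X) {p \<in> topspace (prod_topology Z X). (\<lambda>(z, x). f z x) p \<in> U}"
      unfolding openin_prod_topology_alt
    proof (intro allI impI)
      fix z x assume zx: "(z, x) \<in> {p \<in> topspace (prod_topology Z X). (\<lambda>(z, x). f z x) p \<in> U}"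
      then have z: "z \<in> topspace Z" and "x \<in> {x \<in> topspace X. f z x \<in> U}" by auto
      moreover have "openin X {x \<in> topspace X. f z x \<in> U}"
        using f[OF z] U by (blast intro: openin_continuous_map_preimage)
      ultimately have "\<exists>A K. openin X A \<and> compactin X K \<and> x \<in> A \<and> A \<subseteq> K \<and>
          K \<subseteq> {x \<in> topspace X. f z x \<in> U}"
        by (intro X[unfolded neighbourhood_base_of, rule_format] conjI)
      then obtain A K where A: "openin X A" "x \<in> A" and K: "compactin X K" "A \<subseteq> K"
        "K \<subseteq> {x \<in> topspace X. f z x \<in> U}"
        by blast
      let ?S = "{g \<in> extensional (topspace X). continuous_map X Y g \<and> g ` K \<subseteq> U}"
      have "openin (compact_open_topology X Y) ?S"
        unfolding compact_open_topology_def using K U by (intro topology_generated_by_Basis) blast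
      then have "openin Z {w \<in> topspace Z. f w \<in> ?S}"
        using l openin_continuous_map_preimage by blast
      moreover have "z \<in> {w \<in> topspace Z. f w \<in> ?S}" using z f K by auto
      moreover have "{w \<in> topspace Z. f w \<in> ?S} \<times> A \<subseteq>
          {p \<in> topspace (prod_topology Z X). (\<lambda>(z, x). f z x) p \<in> U}"
        using K A openin_subset[OF A(1)] by (auto simp: image_subset_iff subset_iff)
      ultimately show "\<exists>U' V. openin Z U' \<and> openin X V \<and> z \<in> U' \<and> x \<in> V \<and>
          U' \<times> V \<subseteq> {p \<in> topspace (prod_topology Z X). (\<lambda>(z, x). f z x) p \<in> U}"
        using A by blast
    qed
  qed
qed

lemma Hausdorff_compact_open_topology:
  assumes "Hausdorff_space Y"
  shows "Hausdorff_space (compact_open_topology X Y)"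
  unfolding Hausdorff_space_def topspace_compact_open_topology
proof (intro allI impI)
  fix f g
  assume A: "f \<in> {f \<in> extensional (topspace X). continuous_map X Y f} \<and>
    g \<in> {f \<in> extensional (topspace X). continuous_map X Y f} \<and> f \<noteq> g"
  then obtain x where x: "x \<in> topspace X" "f x \<noteq> g x"
    by (auto intro: extensionalityI)
  moreover have "f x \<in> topspace Y" "g x \<in> topspace Y"
    using A x by (auto simp: continuous_map_def)
  ultimately obtain U V where UV: "openin Y U" "openin Y V" "f x \<in> U" "g x \<in> V" "disjnt U V"
    using assms unfolding Hausdorff_space_def by metis
  let ?S = "\<lambda>U. {h \<in> extensional (topspace X). continuous_map X Y h \<and> h ` {x} \<subseteq> U}"
  have "openin (compact_open_topology X Y) (?S W)" if "openin Y W" for W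
  proof -
    have "compactin X {x}" using x by simp
    with that show ?thesis
      unfolding compact_open_topology_def by (intro topology_generated_by_Basis) blast
  qed
  moreover have "f \<in> ?S U" "g \<in> ?S V" "disjnt (?S U) (?S V)"
    using A UV by (auto simp: disjnt_def)
  ultimately show "\<exists>U V. openin (compact_open_topology X Y) U \<and>
      openin (compact_open_topology X Y) V \<and> f \<in> U \<and> g \<in> V \<and> disjnt U V"
    using UV by blast
qed

section \<open>Monotone maps of intervals\<close>

text \<open>For monotone continuous functions surjectivity only concerns the endpoints, by the intermediate value
  theorem. This reduces closure properties of \<^const>\<open>M_maps\<close> to elementary checks.\<close>
lemma M_maps_iff:
  assumes "0 < a" "0 < b"
  shows "f \<in> M_maps a b \<longleftrightarrow> f \<in> extensional {0..a} \<and> continuous_on {0..a} f \<and>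
    mono_on {0..a} f \<and> f 0 = 0 \<and> f a = b" (is "?l \<longleftrightarrow> ?r")
proof
  assume l: ?l
  then have im: "f ` {0..a} = {0..b}" and mono: "mono_on {0..a} f"
    by (auto simp: M_maps_def)
  obtain s t where st: "s \<in> {0..a}" "f s = 0" "t \<in> {0..a}" "f t = b"
    using im assms by (metis atLeastAtMost_iff imageE order_refl less_imp_le)
  have "f 0 \<in> {0..b}" "f a \<in> {0..b}"
    using im assms by (auto simp flip: im)
  moreover have "f 0 \<le> 0" "b \<le> f a"
    using mono_onD[OF mono, of 0 s] mono_onD[OF mono, of t a] st assms by auto
  ultimately show ?r
    using l by (auto simp: M_maps_def)
next
  assume r: ?r
  then have cont: "continuous_on {0..a} f" and mono: "mono_on {0..a} f" and "f 0 = 0" "f a = b"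
    by auto
  then have le: "f ` {0..a} \<subseteq> {0..b}"
    using mono_onD[OF mono, of 0] mono_onD[OF mono, of _ a] assms by fastforce
  moreover have "{0..b} \<subseteq> f ` {0..a}"
  proof
    fix y assume "y \<in> {0..b}"
    then obtain x where "0 \<le> x" "x \<le> a" "f x = y"
      using IVT'[of f 0 y a] cont assms \<open>f 0 = 0\<close> \<open>f a = b\<close> by auto
    then show "y \<in> f ` {0..a}" by auto
  qed
  ultimately show ?l
    using r by (auto simp: M_maps_def)
qed

text \<open>A continuous bijection from a compact interval to a Hausdorff space is a homeomorphism, so the homeomorphisms are
  exactly the strictly increasing elements of \<^const>\<open>M_maps\<close>.\<close>
lemma G_maps_iff:
  assumes "0 < a" "0 < b"
  shows "f \<in> G_maps a b \<longleftrightarrow> f \<in> M_maps a b \<and> strict_mono_on {0..a} f" (is "?l \<longleftrightarrow> ?r")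
proof
  assume l: ?l
  then have "inj_on f {0..a}" "f ` {0..a} = {0..b}" "mono_on {0..a} f"
    using homeomorphic_imp_surjective_map[of "top_of_set {0..a}" "top_of_set {0..b}" f]
      homeomorphic_imp_injective_map[of "top_of_set {0..a}" "top_of_set {0..b}" f]
    by (auto simp: G_maps_def)
  moreover have "continuous_map (top_of_set {0..a}) (top_of_set {0..b}) f"
    using l by (intro homeomorphic_imp_continuous_map) (simp add: G_maps_def)
  moreover from calculation have "strict_mono_on {0..a} f"
    unfolding strict_mono_on_def mono_on_def inj_on_def by (metis order_le_less order_less_le)
  ultimately show ?r
    using l by (auto simp: G_maps_def M_maps_def)
next
  assume r: ?r
  then have "homeomorphic_map (top_of_set {0..a}) (top_of_set {0..b}) f"
    using strict_mono_on_imp_inj_on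
    by (intro continuous_imp_homeomorphic_map) (auto simp: M_maps_def compact_space_subtopology Hausdorff_space_subtopology)
  then show ?l
    using r by (auto simp: G_maps_def M_maps_def)
qed

lemma M_mapsI:
  assumes "0 < a" "0 < b" "f \<in> extensional {0..a}" "continuous_on {0..a} f"
    "\<And>s t. \<lbrakk>0 \<le> s; s \<le> t; t \<le> a\<rbrakk> \<Longrightarrow> f s \<le> f t" "f 0 = 0" "f a = b"
  shows "f \<in> M_maps a b"
  using assms by (auto simp: M_maps_iff mono_on_def)

lemma G_mapsI:
  assumes "0 < a" "0 < b" "f \<in> extensional {0..a}" "continuous_on {0..a} f"
    "\<And>s t. \<lbrakk>0 \<le> s; s < t; t \<le> a\<rbrakk> \<Longrightarrow> f s < f t" "f 0 = 0" "f a = b"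
  shows "f \<in> G_maps a b"
proof -
  have "strict_mono_on {0..a} f"
    using assms by (auto simp: strict_mono_on_def)
  then show ?thesis
    using assms strict_mono_on_imp_mono_on[of "{0..a}" f] by (auto simp: G_maps_iff M_maps_iff)
qed

lemma M_mapsD:
  assumes "0 < a" "0 < b" "f \<in> M_maps a b"
  shows "f \<in> extensional {0..a}" "continuous_on {0..a} f" "f 0 = 0" "f a = b"
    "\<And>s t. \<lbrakk>0 \<le> s; s \<le> t; t \<le> a\<rbrakk> \<Longrightarrow> f s \<le> f t"
    "\<And>t. \<lbrakk>0 \<le> t; t \<le> a\<rbrakk> \<Longrightarrow> 0 \<le> f t" "\<And>t. \<lbrakk>0 \<le> t; t \<le> a\<rbrakk> \<Longrightarrow> f t \<le> b"
proof -
  have f: "f \<in> extensional {0..a} \<and> continuous_on {0..a} f \<and> mono_on {0..a} f \<and> f 0 = 0 \<and> f a = b"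
    using assms by (simp add: M_maps_iff)
  then show "f \<in> extensional {0..a}" "continuous_on {0..a} f" "f 0 = 0" "f a = b"
    by auto
  show mono: "f s \<le> f t" if "0 \<le> s" "s \<le> t" "t \<le> a" for s t
    using f that by (auto simp: mono_on_def)
  show "0 \<le> f t" "f t \<le> b" if "0 \<le> t" "t \<le> a" for t
    using mono[of 0 t] mono[of t a] f that by auto
qed

lemma G_maps_strict:
  assumes "0 < a" "0 < b" "f \<in> G_maps a b" "0 \<le> s" "s < t" "t \<le> a"
  shows "f s < f t"
  using assms by (auto simp: G_maps_iff strict_mono_on_def)

lemma G_maps_subset_M_maps: "\<lbrakk>0 < a; 0 < b\<rbrakk> \<Longrightarrow> G_maps a b \<subseteq> M_maps a b"
  by (auto simp: G_maps_iff)

text \<open>The tensor product of morphisms in the argument order of \<^const>\<open>Tmor\<close>, as a constant of its own so that it can stay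
  folded.\<close>
definition tensor :: "real \<Rightarrow> real \<Rightarrow> real \<Rightarrow> real \<Rightarrow> (real \<Rightarrow> real) \<Rightarrow> (real \<Rightarrow> real) \<Rightarrow> real \<Rightarrow> real" where
  "tensor a a' b b' \<alpha> \<beta> = (\<lambda>t\<in>{0..a + b}. if t \<le> a then \<alpha> t else a' + \<beta> (t - a))"

lemma interval_category_simps [simp]:
  "Obj (interval_category H) = {0<..}"
  "Comp (interval_category H) a b c g f = compose {0..a} g f"
  "Ident (interval_category H) a = (\<lambda>t\<in>{0..a}. t)"
  "Tobj (interval_category H) = (+)"
  "Tmor (interval_category H) a a' b b' \<alpha> \<beta> = tensor a a' b b' \<alpha> \<beta>"
  by (simp_all add: interval_category_def tensor_def)

lemma topspace_Hom_interval_category [simp]: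
  assumes "H a b \<subseteq> M_maps a b"
  shows "topspace (Hom (interval_category H) a b) = H a b"
  using assms by (auto simp: interval_category_def topspace_compact_open_topology M_maps_def)

text \<open>The tensor product acts separately on the two summands as long as the second starts only once the first is
  complete. This is the source of all naturality statements for cuts.\<close>
lemma tensor_add:
  assumes "0 < a" "0 < a'" "0 < b" "0 < b'" "\<alpha> \<in> M_maps a a'" "\<beta> \<in> M_maps b b'"
    "0 \<le> x" "x \<le> a" "0 \<le> y" "y \<le> b" "x = a \<or> y = 0"
  shows "tensor a a' b b' \<alpha> \<beta> (x + y) = \<alpha> x + \<beta> y"
  using assms M_mapsD(3,4)[of a a' \<alpha>] M_mapsD(3,4)[of b b' \<beta>]
  by (cases "y = 0") (auto simp: tensor_def)

text \<open>A formula without case distinction, from which continuity and monotonicity can be read off.\<close>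
lemma tensor_eq:
  assumes "0 < a" "0 < a'" "0 < b" "0 < b'" "\<alpha> \<in> M_maps a a'" "\<beta> \<in> M_maps b b'" "t \<in> {0..a + b}"
  shows "tensor a a' b b' \<alpha> \<beta> t = \<alpha> (min t a) + \<beta> (max (t - a) 0)"
proof -
  have "t = min t a + max (t - a) 0" by auto
  moreover have "tensor a a' b b' \<alpha> \<beta> (min t a + max (t - a) 0) = \<alpha> (min t a) + \<beta> (max (t - a) 0)"
    using assms by (intro tensor_add) auto
  ultimately show ?thesis by simp
qed

lemma tensor_M_maps:
  assumes "0 < a" "0 < a'" "0 < b" "0 < b'" "\<alpha> \<in> M_maps a a'" "\<beta> \<in> M_maps b b'"
  shows "tensor a a' b b' \<alpha> \<beta> \<in> M_maps (a + b) (a' + b')"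
proof (rule M_mapsI)
  note \<alpha> = M_mapsD[OF assms(1,2,5)] and \<beta> = M_mapsD[OF assms(3,4,6)]
  have "continuous_on {0..a + b} (\<lambda>t. \<alpha> (min t a) + \<beta> (max (t - a) 0))"
    using assms by (intro continuous_intros continuous_on_compose2[OF \<alpha>(2)]
        continuous_on_compose2[OF \<beta>(2)]) auto
  then show "continuous_on {0..a + b} (tensor a a' b b' \<alpha> \<beta>)"
    by (rule continuous_on_eq) (simp add: tensor_eq assms)
  fix s t assume "0 \<le> s" "s \<le> t" "t \<le> a + b"
  with assms show "tensor a a' b b' \<alpha> \<beta> s \<le> tensor a a' b b' \<alpha> \<beta> t"
    by (auto simp: tensor_eq intro!: add_mono \<alpha>(5) \<beta>(5))
qed (use assms M_mapsD(3,4)[OF assms(1,2,5)] M_mapsD(3,4)[OF assms(3,4,6)] in \<open>auto simp: tensor_eq\<close>,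
    auto simp: tensor_def)

lemma tensor_G_maps:
  assumes "0 < a" "0 < a'" "0 < b" "0 < b'" "\<alpha> \<in> G_maps a a'" "\<beta> \<in> G_maps b b'"
  shows "tensor a a' b b' \<alpha> \<beta> \<in> G_maps (a + b) (a' + b')"
proof -
  have M: "\<alpha> \<in> M_maps a a'" "\<beta> \<in> M_maps b b'"
    using assms by (auto simp: G_maps_iff)
  note \<alpha> = M_mapsD[OF assms(1,2) M(1)] and \<beta> = M_mapsD[OF assms(3,4) M(2)]
  have "tensor a a' b b' \<alpha> \<beta> s < tensor a a' b b' \<alpha> \<beta> t" if st: "0 \<le> s" "s < t" "t \<le> a + b" for s t
  proof (cases "s < a")
    case True
    then have "\<alpha> (min s a) < \<alpha> (min t a)"
      using assms st by (intro G_maps_strict[OF assms(1,2,5)]) auto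
    moreover have "\<beta> (max (s - a) 0) \<le> \<beta> (max (t - a) 0)"
      using assms st by (intro \<beta>(5)) auto
    ultimately show ?thesis
      using assms M st by (simp add: tensor_eq)
  next
    case False
    then have "\<beta> (max (s - a) 0) < \<beta> (max (t - a) 0)"
      using assms st by (intro G_maps_strict[OF assms(3,4,6)]) auto
    then show ?thesis
      using assms M st False by (simp add: tensor_eq)
  qed
  then show ?thesis
    using tensor_M_maps[OF assms(1-4) M] assms by (auto simp: G_maps_iff strict_mono_on_def)
qed

lemma compose_M_maps:
  assumes "0 < a" "0 < b" "0 < c" "f \<in> M_maps a b" "g \<in> M_maps b c"
  shows "compose {0..a} g f \<in> M_maps a c"
proof (rule M_mapsI)
  note f = M_mapsD[OF assms(1,2,4)] and g = M_mapsD[OF assms(2,3,5)]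
  have "continuous_on {0..a} (\<lambda>t. g (f t))"
    by (intro continuous_on_compose2[OF g(2) f(2)]) (use f in auto)
  then show "continuous_on {0..a} (compose {0..a} g f)"
    by (rule continuous_on_eq) (simp add: compose_eq)
  fix s t assume "0 \<le> s" "s \<le> t" "t \<le> a"
  then show "compose {0..a} g f s \<le> compose {0..a} g f t"
    by (simp add: compose_eq f g)
qed (use assms M_mapsD(3,4)[OF assms(1,2,4)] M_mapsD(3,4)[OF assms(2,3,5)] in \<open>auto simp: compose_eq\<close>)

lemma compose_G_maps:
  assumes "0 < a" "0 < b" "0 < c" "f \<in> G_maps a b" "g \<in> G_maps b c"
  shows "compose {0..a} g f \<in> G_maps a c"
proof -
  have M: "f \<in> M_maps a b" "g \<in> M_maps b c"
    using assms by (auto simp: G_maps_iff)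
  have "compose {0..a} g f s < compose {0..a} g f t" if "0 \<le> s" "s < t" "t \<le> a" for s t
    using that M_mapsD[OF assms(1,2) M(1)]
    by (simp add: compose_eq G_maps_strict[OF assms(1,2,4)] G_maps_strict[OF assms(2,3,5)])
  then show ?thesis
    using compose_M_maps[OF assms(1-3) M] assms by (auto simp: G_maps_iff strict_mono_on_def)
qed

lemma linear_G_maps:
  assumes "0 < a" "0 < b"
  shows "(\<lambda>t\<in>{0..a}. b / a * t) \<in> G_maps a b"
proof (rule G_mapsI)
  have "continuous_on {0..a} (\<lambda>t. b / a * t)"
    by (intro continuous_intros)
  then show "continuous_on {0..a} (\<lambda>t\<in>{0..a}. b / a * t)"
    by (rule continuous_on_eq) simp
qed (use assms in \<open>auto simp: divide_strict_right_mono\<close>)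

lemma tensor_compose:
  assumes pos: "0 < a" "0 < a'" "0 < a''" "0 < b" "0 < b'" "0 < b''"
    and f: "f \<in> M_maps a a'" "f' \<in> M_maps a' a''" and g: "g \<in> M_maps b b'" "g' \<in> M_maps b' b''"
  shows "tensor a a'' b b'' (compose {0..a} f' f) (compose {0..b} g' g) =
    compose {0..a + b} (tensor a' a'' b' b'' f' g') (tensor a a' b b' f g)"
proof (rule extensionalityI[of _ "{0..a + b}"])
  fix t assume t: "t \<in> {0..a + b}"
  define x y where "x = min t a" and "y = max (t - a) 0"
  have xy: "0 \<le> x" "x \<le> a" "0 \<le> y" "y \<le> b" "x = a \<or> y = 0"
    using t pos by (auto simp: x_def y_def)
  note fD = M_mapsD[OF pos(1,2) f(1)] and gD = M_mapsD[OF pos(4,5) g(1)]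
  have "tensor a' a'' b' b'' f' g' (f x + g y) = f' (f x) + g' (g y)"
    using xy fD gD by (intro tensor_add pos f g) auto
  then show "tensor a a'' b b'' (compose {0..a} f' f) (compose {0..b} g' g) t =
      compose {0..a + b} (tensor a' a'' b' b'' f' g') (tensor a a' b b' f g) t"
    using t xy by (simp add: tensor_eq pos f g compose_M_maps[of _ a' a''] compose_M_maps[of _ b' b'']
        compose_eq flip: x_def y_def)
qed (auto simp: tensor_def)

lemma tensor_assoc:
  assumes "0 < a" "0 < b" "0 < c"
  shows "tensor (a + b) (a' + b') c c' (tensor a a' b b' f g) h =
    tensor a a' (b + c) (b' + c') f (tensor b b' c c' g h)"
  using assms by (auto simp: tensor_def fun_eq_iff restrict_def algebra_simps)

text \<open>Convex combinations with the linear map stay in the hom-set; they form the contraction of the hom-space.\<close>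
lemma straighten_M_maps:
  assumes "0 < a" "0 < b" "f \<in> M_maps a b" "0 \<le> u" "u \<le> 1"
  shows "(\<lambda>t\<in>{0..a}. (1 - u) * f t + u * (b / a * t)) \<in> M_maps a b"
proof (rule M_mapsI)
  note f = M_mapsD[OF assms(1-3)]
  have "continuous_on {0..a} (\<lambda>t. (1 - u) * f t + u * (b / a * t))"
    using f by (intro continuous_intros)
  then show "continuous_on {0..a} (\<lambda>t\<in>{0..a}. (1 - u) * f t + u * (b / a * t))"
    by (rule continuous_on_eq) simp
  fix s t assume st: "0 \<le> s" "s \<le> t" "t \<le> a"
  then have "f s \<le> f t" "b / a * s \<le> b / a * t"
    using f(5) assms by (auto simp del: times_divide_eq_left intro!: mult_left_mono)
  then show "(\<lambda>t\<in>{0..a}. (1 - u) * f t + u * (b / a * t)) s \<le> (\<lambda>t\<in>{0..a}. (1 - u) * f t + u * (b / a * t)) t"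
    using st assms(4,5) by (auto simp del: times_divide_eq_left intro!: add_mono mult_left_mono)
qed (use assms M_mapsD(3,4)[OF assms(1-3)] in \<open>auto simp: algebra_simps\<close>)

lemma straighten_G_maps:
  assumes "0 < a" "0 < b" "f \<in> G_maps a b" "0 \<le> u" "u \<le> 1"
  shows "(\<lambda>t\<in>{0..a}. (1 - u) * f t + u * (b / a * t)) \<in> G_maps a b"
proof -
  have M: "f \<in> M_maps a b"
    using assms by (auto simp: G_maps_iff)
  have "(1 - u) * f s + u * (b / a * s) < (1 - u) * f t + u * (b / a * t)"
    if st: "0 \<le> s" "s < t" "t \<le> a" for s t
  proof -
    have 1: "f s < f t" "b / a * s < b / a * t"
      using G_maps_strict[OF assms(1-3)] st assms by (auto simp: divide_strict_right_mono)
    show ?thesis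
    proof (cases "u = 0")
      case False
      then have "u * (b / a * s) < u * (b / a * t)"
        using 1(2) assms False by (intro mult_strict_left_mono[OF 1(2)]) auto
      moreover have "(1 - u) * f s \<le> (1 - u) * f t"
        using 1 assms by (intro mult_left_mono) auto
      ultimately show ?thesis by linarith
    qed (use 1 in simp)
  qed
  then show ?thesis
    using straighten_M_maps[OF assms(1,2) M assms(4,5)] assms
    by (auto simp: G_maps_iff strict_mono_on_def)
qed

lemma restrict_M_maps:
  assumes "0 < l" "0 < s" "s < l" "0 < a" "0 < b" "f \<in> M_maps l (a + b)" "f s = a"
  shows "(\<lambda>t\<in>{0..s}. f t) \<in> M_maps s a"
proof (rule M_mapsI)
  have "continuous_on {0..l} f"
    using assms by (simp add: M_maps_iff)
  then have "continuous_on {0..s} f"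
    by (rule continuous_on_subset) (use assms in auto)
  then show "continuous_on {0..s} (\<lambda>t\<in>{0..s}. f t)"
    by (rule continuous_on_eq) simp
qed (use assms M_mapsD[of l "a + b" f] in auto)

lemma shift_M_maps:
  assumes "0 < l" "0 < s" "s < l" "0 < a" "0 < b" "f \<in> M_maps l (a + b)" "f s = a"
  shows "(\<lambda>t\<in>{0..l - s}. f (s + t) - a) \<in> M_maps (l - s) b"
proof (rule M_mapsI)
  have f: "continuous_on {0..l} f"
    using assms by (simp add: M_maps_iff)
  have "continuous_on {0..l - s} (\<lambda>t. f (s + t) - a)"
    by (intro continuous_intros continuous_on_compose2[OF f]) (use assms in auto)
  then show "continuous_on {0..l - s} (\<lambda>t\<in>{0..l - s}. f (s + t) - a)"
    by (rule continuous_on_eq) simp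
qed (use assms M_mapsD[of l "a + b" f] in auto)

text \<open>A map to \<open>a \<otimes> b\<close> decomposes into a tensor product: cut the source at a time where the value is \<open>a\<close>,
  which exists by the intermediate value theorem.\<close>
lemma M_maps_split:
  assumes pos: "0 < l" "0 < a" "0 < b" and f: "f \<in> M_maps l (a + b)"
  obtains s where "0 < s" "s < l" "f s = a"
    "tensor s a (l - s) b (\<lambda>t\<in>{0..s}. f t) (\<lambda>t\<in>{0..l - s}. f (s + t) - a) = f"
proof -
  have ab: "0 < a + b" using pos by simp
  note fD = M_mapsD[OF pos(1) ab f]
  have "\<exists>s\<ge>0. s \<le> l \<and> f s = a"
    using fD pos by (intro IVT') auto
  then obtain s where s: "0 \<le> s" "s \<le> l" "f s = a" by blast
  moreover have "s \<noteq> 0" "s \<noteq> l" using s fD pos by auto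
  moreover have "tensor s a (l - s) b (\<lambda>t\<in>{0..s}. f t) (\<lambda>t\<in>{0..l - s}. f (s + t) - a) = f"
    by (rule extensionalityI[of _ "{0..l}"]) (use fD(1) s in \<open>auto simp: tensor_def\<close>)
  ultimately show thesis
    by (intro that[of s]) auto
qed

section \<open>The interval categories are reparametrization categories\<close>

text \<open>The bridge between hom-spaces and analysis: a simplex of maps is continuous iff the associated function of two
  variables is jointly continuous.\<close>
lemma continuous_map_simplex_into_Hom:
  assumes "0 < a" "0 < b" and H: "H a b \<subseteq> M_maps a b"
  shows "continuous_map (simplex_topology n) (Hom (interval_category H) a b) \<phi> \<longleftrightarrow>
    (\<forall>z\<in>standard_simplex n. \<phi> z \<in> H a b) \<and>
    continuous_on (standard_simplex n \<times> {0..a}) (\<lambda>p. \<phi> (fst p) (snd p))"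
proof (cases "\<forall>z\<in>standard_simplex n. \<phi> z \<in> H a b")
  case True
  let ?I = "top_of_set {0..a}" and ?J = "top_of_set {0..b}"
  have \<phi>: "\<phi> z \<in> extensional {0..a} \<and> continuous_map ?I ?J (\<phi> z)" if "z \<in> standard_simplex n" for z
    using True H that by (auto simp: M_maps_def)
  have "neighbourhood_base_of (compactin ?I) ?I"
    by (intro locally_compact_space_neighbourhood_base[THEN iffD1] compact_imp_locally_compact_space)
       (simp_all add: compact_space_subtopology Hausdorff_space_subtopology)
  then have "continuous_map (simplex_topology n) (compact_open_topology ?I ?J) \<phi> \<longleftrightarrow>
      continuous_map (prod_topology (simplex_topology n) ?I) ?J (\<lambda>(z, t). \<phi> z t)"
    using \<phi> by (intro continuous_map_into_compact_open_topology) auto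
  also have "\<dots> \<longleftrightarrow> continuous_on (standard_simplex n \<times> {0..a}) (\<lambda>p. \<phi> (fst p) (snd p))"
  proof -
    have "(\<lambda>p. \<phi> (fst p) (snd p)) \<in> standard_simplex n \<times> {0..a} \<rightarrow> {0..b}"
      using \<phi> by (auto simp: Pi_iff)
    then show ?thesis
      by (simp only: simplex_topology_eq prod_topology_subtopology_eu continuous_map_subtopology_eu
          case_prod_unfold simp_thms)
  qed
  finally show ?thesis
    using True
    by (simp add: interval_category_def continuous_map_simplex_into_delta_kelleyfication
        continuous_map_in_subtopology[of _ _ "H a b"] Pi_iff)
next
  case False
  then show ?thesis
    by (auto simp: interval_category_def continuous_map_simplex_into_delta_kelleyfication
        continuous_map_in_subtopology[of _ _ "H a b"])
qed

lemma continuous_on_family_compose: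
  assumes "continuous_on (S \<times> T) (\<lambda>p. \<phi> (fst p) (snd p))" "continuous_on A h" "continuous_on A k"
    "\<And>x. x \<in> A \<Longrightarrow> h x \<in> S" "\<And>x. x \<in> A \<Longrightarrow> k x \<in> T"
  shows "continuous_on A (\<lambda>x. \<phi> (h x) (k x))"
  using continuous_on_compose2[OF assms(1) continuous_on_Pair[OF assms(2,3)]] assms(4,5) by auto

text \<open>The closure properties shared by \<^const>\<open>M_maps\<close> and \<^const>\<open>G_maps\<close> from which the axioms of a
  reparametrization category follow. The condition \<open>straighten_mem\<close> makes the hom-spaces star-shaped around the linear map, hence
  contractible.\<close>
locale interval_maps =
  fixes H :: "real \<Rightarrow> real \<Rightarrow> (real \<Rightarrow> real) set"
  assumes subset_M: "\<lbrakk>0 < a; 0 < b\<rbrakk> \<Longrightarrow> H a b \<subseteq> M_maps a b"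
    and linear_mem: "\<lbrakk>0 < a; 0 < b\<rbrakk> \<Longrightarrow> (\<lambda>t\<in>{0..a}. b / a * t) \<in> H a b"
    and compose_mem: "\<lbrakk>0 < a; 0 < b; 0 < c; f \<in> H a b; g \<in> H b c\<rbrakk> \<Longrightarrow> compose {0..a} g f \<in> H a c"
    and tensor_mem: "\<lbrakk>0 < a; 0 < a'; 0 < b; 0 < b'; \<alpha> \<in> H a a'; \<beta> \<in> H b b'\<rbrakk> \<Longrightarrow>
      tensor a a' b b' \<alpha> \<beta> \<in> H (a + b) (a' + b')"
    and straighten_mem: "\<lbrakk>0 < a; 0 < b; f \<in> H a b; 0 \<le> u; u \<le> 1\<rbrakk> \<Longrightarrow>
      (\<lambda>t\<in>{0..a}. (1 - u) * f t + u * (b / a * t)) \<in> H a b"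
    and split_mem: "\<lbrakk>0 < l; 0 < s; s < l; 0 < a; 0 < b; f \<in> H l (a + b); f s = a\<rbrakk> \<Longrightarrow>
      (\<lambda>t\<in>{0..s}. f t) \<in> H s a \<and> (\<lambda>t\<in>{0..l - s}. f (s + t) - a) \<in> H (l - s) b"
begin

abbreviation "P \<equiv> interval_category H"

lemma in_M: "\<lbrakk>0 < a; 0 < b; f \<in> H a b\<rbrakk> \<Longrightarrow> f \<in> M_maps a b"
  using subset_M by blast

lemma topspace_Hom: "\<lbrakk>0 < a; 0 < b\<rbrakk> \<Longrightarrow> topspace (Hom P a b) = H a b"
  by (simp add: subset_M)

lemma continuous_map_HomI:
  assumes "0 < a" "0 < b" "\<And>z. z \<in> standard_simplex n \<Longrightarrow> \<phi> z \<in> H a b"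
    "continuous_on (standard_simplex n \<times> {0..a}) (\<lambda>p. \<phi> (fst p) (snd p))"
  shows "continuous_map (simplex_topology n) (Hom P a b) \<phi>"
  using continuous_map_simplex_into_Hom[of a b H] subset_M assms by blast

lemma continuous_map_HomD:
  assumes "0 < a" "0 < b" "continuous_map (simplex_topology n) (Hom P a b) \<phi>"
  shows "\<And>z. z \<in> standard_simplex n \<Longrightarrow> \<phi> z \<in> H a b"
    "continuous_on (standard_simplex n \<times> {0..a}) (\<lambda>p. \<phi> (fst p) (snd p))"
  using continuous_map_simplex_into_Hom[of a b H] subset_M assms by blast+

lemma delta_generated_Hom: "delta_generated (Hom P a b)"
  by (simp add: interval_category_def delta_generated_delta_kelleyfication)

lemma delta_Hausdorff_Hom: "delta_Hausdorff (Hom P a b)"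
  by (simp add: interval_category_def delta_Hausdorff_delta_kelleyfication
      Hausdorff_space_subtopology Hausdorff_compact_open_topology)

text \<open>An operation between hom-spaces is continuous as soon as it turns jointly continuous families of maps into
  jointly continuous families.\<close>
lemma continuous_map_Hom_HomI:
  assumes "0 < L" "0 < m" "0 < a" "0 < b"
    and c: "\<And>\<psi>. \<psi> \<in> H L m \<Longrightarrow> c \<psi> \<in> H a b"
    and cont: "\<And>(S::(nat \<Rightarrow> real) set) \<phi>. \<lbrakk>\<And>z. z \<in> S \<Longrightarrow> \<phi> z \<in> H L m;
        continuous_on (S \<times> {0..L}) (\<lambda>p. \<phi> (fst p) (snd p))\<rbrakk>
      \<Longrightarrow> continuous_on (S \<times> {0..a}) (\<lambda>p. c (\<phi> (fst p)) (snd p))"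
  shows "continuous_map (Hom P L m) (Hom P a b) c"
proof (rule continuous_map_from_delta_generated[OF delta_generated_Hom])
  fix n \<phi> assume "continuous_map (simplex_topology n) (Hom P L m) \<phi>"
  note \<phi> = continuous_map_HomD[OF assms(1,2) this]
  show "continuous_map (simplex_topology n) (Hom P a b) (c \<circ> \<phi>)"
    using assms(3,4) c \<phi>(1) cont[OF \<phi>] by (intro continuous_map_HomI) simp_all
qed

text \<open>The same principle for homotopies; the time also varies with the parameter.\<close>
lemma continuous_map_homotopy_HomI:
  assumes "0 < L" "0 < m" "0 < a" "0 < b"
    and h: "\<And>u \<psi>. \<lbrakk>0 \<le> u; u \<le> 1; \<psi> \<in> H L m\<rbrakk> \<Longrightarrow> h u \<psi> \<in> H a b"
    and cont: "\<And>(S::(nat \<Rightarrow> real) set) \<upsilon> \<phi>. \<lbrakk>\<And>z. z \<in> S \<Longrightarrow> 0 \<le> \<upsilon> z \<and> \<upsilon> z \<le> (1::real); continuous_on S \<upsilon>;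
        \<And>z. z \<in> S \<Longrightarrow> \<phi> z \<in> H L m; continuous_on (S \<times> {0..L}) (\<lambda>p. \<phi> (fst p) (snd p))\<rbrakk>
      \<Longrightarrow> continuous_on (S \<times> {0..a}) (\<lambda>p. h (\<upsilon> (fst p)) (\<phi> (fst p)) (snd p))"
  shows "continuous_map (Top_prod (top_of_set {0..1}) (Hom P L m)) (Hom P a b) (\<lambda>(u, \<psi>). h u \<psi>)"
proof (rule continuous_map_from_Top_prod)
  fix n \<upsilon> \<phi>
  assume \<upsilon>: "continuous_map (simplex_topology n) (top_of_set {0..1::real}) \<upsilon>"
    and "continuous_map (simplex_topology n) (Hom P L m) \<phi>"
  note \<phi> = continuous_map_HomD[OF assms(1,2) this(2)]
  have u: "continuous_on (standard_simplex n) \<upsilon>" "\<And>z. z \<in> standard_simplex n \<Longrightarrow> 0 \<le> \<upsilon> z \<and> \<upsilon> z \<le> 1"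
    using \<upsilon> by (auto simp: simplex_topology_eq)
  show "continuous_map (simplex_topology n) (Hom P a b) (\<lambda>z. case (\<upsilon> z, \<phi> z) of (u, \<psi>) \<Rightarrow> h u \<psi>)"
    using assms(3,4) h u(2) \<phi>(1) cont[OF u(2,1) \<phi>] by (intro continuous_map_HomI) simp_all
qed

lemma continuous_map_compose_Hom:
  assumes "0 < a" "0 < b" "0 < c"
  shows "continuous_map (Top_prod (Hom P b c) (Hom P a b)) (Hom P a c) (\<lambda>(g, f). compose {0..a} g f)"
proof (rule continuous_map_from_Top_prod)
  fix n \<psi> \<phi>
  assume c: "continuous_map (simplex_topology n) (Hom P b c) \<psi>"
    "continuous_map (simplex_topology n) (Hom P a b) \<phi>"
  have \<psi>: "\<And>z. z \<in> standard_simplex n \<Longrightarrow> \<psi> z \<in> H b c"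
      "continuous_on (standard_simplex n \<times> {0..b}) (\<lambda>p. \<psi> (fst p) (snd p))"
    and \<phi>: "\<And>z. z \<in> standard_simplex n \<Longrightarrow> \<phi> z \<in> H a b"
      "continuous_on (standard_simplex n \<times> {0..a}) (\<lambda>p. \<phi> (fst p) (snd p))"
    by (simp_all add: continuous_map_HomD[OF _ _ c(1)] continuous_map_HomD[OF _ _ c(2)] assms)
  have "continuous_on (standard_simplex n \<times> {0..a}) (\<lambda>p. \<psi> (fst p) (\<phi> (fst p) (snd p)))"
    by (intro continuous_on_family_compose[OF \<psi>(2)] continuous_intros \<phi>(2))
       (use M_mapsD(6,7)[OF assms(1,2) in_M[OF assms(1,2) \<phi>(1)]] in auto)
  then have "continuous_on (standard_simplex n \<times> {0..a}) (\<lambda>p. compose {0..a} (\<psi> (fst p)) (\<phi> (fst p)) (snd p))"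
    by (rule continuous_on_eq) (auto simp: compose_eq)
  then show "continuous_map (simplex_topology n) (Hom P a c)
      (\<lambda>z. case (\<psi> z, \<phi> z) of (g, f) \<Rightarrow> compose {0..a} g f)"
    using assms \<psi>(1) \<phi>(1) compose_mem by (intro continuous_map_HomI) simp_all
qed

lemma continuous_map_tensor_Hom:
  assumes "0 < a" "0 < a'" "0 < b" "0 < b'"
  shows "continuous_map (Top_prod (Hom P a a') (Hom P b b')) (Hom P (a + b) (a' + b'))
    (\<lambda>(f, g). tensor a a' b b' f g)"
proof (rule continuous_map_from_Top_prod)
  fix n \<phi> \<psi>
  assume c: "continuous_map (simplex_topology n) (Hom P a a') \<phi>"
    "continuous_map (simplex_topology n) (Hom P b b') \<psi>"
  have \<psi>: "\<And>z. z \<in> standard_simplex n \<Longrightarrow> \<psi> z \<in> H b b'"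
      "continuous_on (standard_simplex n \<times> {0..b}) (\<lambda>p. \<psi> (fst p) (snd p))"
    and \<phi>: "\<And>z. z \<in> standard_simplex n \<Longrightarrow> \<phi> z \<in> H a a'"
      "continuous_on (standard_simplex n \<times> {0..a}) (\<lambda>p. \<phi> (fst p) (snd p))"
    by (simp_all add: continuous_map_HomD[OF _ _ c(1)] continuous_map_HomD[OF _ _ c(2)] assms)
  have "continuous_on (standard_simplex n \<times> {0..a + b})
      (\<lambda>p. \<phi> (fst p) (min (snd p) a) + \<psi> (fst p) (max (snd p - a) 0))"
    by (intro continuous_on_add continuous_on_family_compose[OF \<psi>(2)]
        continuous_on_family_compose[OF \<phi>(2)] continuous_intros) (use assms in auto)
  then have "continuous_on (standard_simplex n \<times> {0..a + b})
      (\<lambda>p. tensor a a' b b' (\<phi> (fst p)) (\<psi> (fst p)) (snd p))"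
    by (rule continuous_on_eq) (auto simp: tensor_eq assms \<phi>(1) \<psi>(1) in_M)
  then show "continuous_map (simplex_topology n) (Hom P (a + b) (a' + b'))
      (\<lambda>z. case (\<phi> z, \<psi> z) of (f, g) \<Rightarrow> tensor a a' b b' f g)"
    using assms \<psi>(1) \<phi>(1) tensor_mem by (intro continuous_map_HomI) simp_all
qed

text \<open>The straight-line contraction to the linear map is continuous on the \<open>\<Delta>\<close>-generated product, which here coincides
  with the ordinary one.\<close>
lemma contractible_space_Hom:
  assumes "0 < a" "0 < b"
  shows "contractible_space (Hom P a b)"
proof -
  define h where "h = (\<lambda>u f. \<lambda>t\<in>{0..a}. (1 - u) * f t + u * (b / a * t))"
  have "continuous_map (Top_prod (top_of_set {0..1}) (Hom P a b)) (Hom P a b) (\<lambda>(u, f). h u f)"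
  proof (rule continuous_map_homotopy_HomI[OF assms assms])
    fix S :: "(nat \<Rightarrow> real) set" and \<upsilon> :: "(nat \<Rightarrow> real) \<Rightarrow> real" and \<phi> :: "(nat \<Rightarrow> real) \<Rightarrow> real \<Rightarrow> real"
    assume \<phi>: "continuous_on S \<upsilon>" "continuous_on (S \<times> {0..a}) (\<lambda>p. \<phi> (fst p) (snd p))"
    have "continuous_on (S \<times> {0..a})
        (\<lambda>p. (1 - \<upsilon> (fst p)) * \<phi> (fst p) (snd p) + \<upsilon> (fst p) * (b / a * snd p))"
      by (intro continuous_intros \<phi>(2) continuous_on_compose2[OF \<phi>(1)]) auto
    then show "continuous_on (S \<times> {0..a}) (\<lambda>p. h (\<upsilon> (fst p)) (\<phi> (fst p)) (snd p))"
      by (rule continuous_on_eq) (auto simp: h_def)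
  qed (unfold h_def, rule straighten_mem[OF assms])
  moreover have "Top_prod (top_of_set {0..1}) (Hom P a b) = prod_topology (top_of_set {0..1::real}) (Hom P a b)"
    using delta_generated_interval_product[OF delta_generated_Hom]
    by (simp add: Top_prod_def delta_generated_def)
  moreover have "h 0 f = f" if "f \<in> H a b" for f
    using M_mapsD(1)[OF assms in_M[OF assms that]]
    by (auto simp: h_def fun_eq_iff extensional_def)
  ultimately show ?thesis
    unfolding contractible_space_def
    by (intro exI[of _ "\<lambda>t\<in>{0..a}. b / a * t"] homotopic_with[THEN iffD2] exI[of _ "\<lambda>(u, f). h u f"])
       (auto simp: topspace_Hom assms h_def)
qed

lemma reparametrization_category:
  assumes Top: "Top = delta_generated \<or> Top = (\<lambda>X. delta_generated X \<and> delta_Hausdorff X)"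
  shows "reparametrization_category Top P"
proof unfold_locales
  show "Top (Hom P a b)" for a b
    using Top delta_generated_Hom delta_Hausdorff_Hom by auto
  have pi: "f \<in> {0..a} \<rightarrow> {0..b}" "f \<in> extensional {0..a}" if "0 < a" "0 < b" "f \<in> H a b" for a b f
    using M_mapsD[OF that(1,2) in_M[OF that]] by auto
  show "Ident P a \<in> topspace (Hom P a a)" if "a \<in> Obj P" for a
  proof -
    have "(\<lambda>t\<in>{0..a}. a / a * t) = Ident P a"
      using that by auto
    then show ?thesis
      using linear_mem[of a a] that by (simp add: topspace_Hom)
  qed
  show "Comp P a b d (Comp P b c d h g) f = Comp P a c d h (Comp P a b c g f)"
    if "a \<in> Obj P" "b \<in> Obj P" "c \<in> Obj P" "d \<in> Obj P" "f \<in> topspace (Hom P a b)"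
      "g \<in> topspace (Hom P b c)" "h \<in> topspace (Hom P c d)" for a b c d f g h
    using that pi(1)[of a b f] by (simp add: topspace_Hom compose_assoc[of f "{0..a}" "{0..b}"])
  show "Comp P a b b (Ident P b) f = f" if "a \<in> Obj P" "b \<in> Obj P" "f \<in> topspace (Hom P a b)" for a b f
    using that pi[of a b f] by (simp add: topspace_Hom Id_compose)
  show "Comp P a a b f (Ident P a) = f" if "a \<in> Obj P" "b \<in> Obj P" "f \<in> topspace (Hom P a b)" for a b f
    using that pi[of a b f] by (simp add: topspace_Hom compose_Id)
  show "Tmor P a a b b (Ident P a) (Ident P b) = Ident P (Tobj P a b)" for a b
    by (auto simp: tensor_def fun_eq_iff restrict_def)
  show "Tmor P a a'' b b'' (Comp P a a' a'' f' f) (Comp P b b' b'' g' g) =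
      Comp P (Tobj P a b) (Tobj P a' b') (Tobj P a'' b'')
        (Tmor P a' a'' b' b'' f' g') (Tmor P a a' b b' f g)"
    if "a \<in> Obj P" "a' \<in> Obj P" "a'' \<in> Obj P" "b \<in> Obj P" "b' \<in> Obj P" "b'' \<in> Obj P"
      "f \<in> topspace (Hom P a a')" "f' \<in> topspace (Hom P a' a'')"
      "g \<in> topspace (Hom P b b')" "g' \<in> topspace (Hom P b' b'')" for a a' a'' b b' b'' f f' g g'
    using that by (simp add: topspace_Hom tensor_compose in_M)
  show "\<exists>l1\<in>Obj P. \<exists>l2\<in>Obj P. \<exists>\<phi>1\<in>topspace (Hom P l1 a). \<exists>\<phi>2\<in>topspace (Hom P l2 b).
      l = Tobj P l1 l2 \<and> \<phi> = Tmor P l1 a l2 b \<phi>1 \<phi>2"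
    if "l \<in> Obj P" "a \<in> Obj P" "b \<in> Obj P" "\<phi> \<in> topspace (Hom P l (Tobj P a b))" for l a b \<phi>
  proof -
    have pos: "0 < l" "0 < a" "0 < b" and \<phi>: "\<phi> \<in> H l (a + b)"
      using that by (auto simp: topspace_Hom)
    then obtain s where s: "0 < s" "s < l" "\<phi> s = a"
      "tensor s a (l - s) b (\<lambda>t\<in>{0..s}. \<phi> t) (\<lambda>t\<in>{0..l - s}. \<phi> (s + t) - a) = \<phi>"
      using M_maps_split[OF pos in_M[OF _ _ \<phi>]] by auto
    with split_mem[OF pos(1) s(1,2) pos(2,3) \<phi> s(3)] pos show ?thesis
      by (intro bexI[of _ s] bexI[of _ "l - s"] bexI[of _ "\<lambda>t\<in>{0..s}. \<phi> t"]
          bexI[of _ "\<lambda>t\<in>{0..l - s}. \<phi> (s + t) - a"]) (auto simp: topspace_Hom)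
  qed
  show "topspace (Hom P a b) \<noteq> {}" if "a \<in> Obj P" "b \<in> Obj P" for a b
    using that linear_mem[of a b] by (auto simp: topspace_Hom)
qed (auto simp: continuous_map_compose_Hom continuous_map_tensor_Hom contractible_space_Hom
    tensor_assoc)

end

interpretation M: interval_maps M_maps
proof
  fix l s a b f assume A: "0 < l" "0 < s" "s < l" "0 < a" "0 < b" "f \<in> M_maps l (a + b)" "f s = (a::real)"
  then show "(\<lambda>t\<in>{0..s}. f t) \<in> M_maps s a \<and> (\<lambda>t\<in>{0..l - s}. f (s + t) - a) \<in> M_maps (l - s) b"
    by (blast intro: restrict_M_maps shift_M_maps)
qed (use G_maps_subset_M_maps in \<open>blast intro: compose_M_maps tensor_M_maps linear_G_maps
    straighten_M_maps\<close>)+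

interpretation G: interval_maps G_maps
proof
  fix l s a b f assume A: "0 < l" "0 < s" "s < l" "0 < a" "0 < b" "f \<in> G_maps l (a + b)" "f s = (a::real)"
  then have f: "f \<in> M_maps l (a + b)" and less: "\<And>x y. \<lbrakk>0 \<le> x; x < y; y \<le> l\<rbrakk> \<Longrightarrow> f x < f y"
    using G_maps_strict[of l "a + b" f] by (auto simp: G_maps_iff)
  show "(\<lambda>t\<in>{0..s}. f t) \<in> G_maps s a \<and> (\<lambda>t\<in>{0..l - s}. f (s + t) - a) \<in> G_maps (l - s) b"
    using restrict_M_maps[OF A(1-5) f A(7)] shift_M_maps[OF A(1-5) f A(7)] A less
    by (auto simp: G_maps_iff strict_mono_on_def)
qed (intro G_maps_subset_M_maps linear_G_maps compose_G_maps tensor_G_maps straighten_G_maps;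
    assumption)+

section \<open>Cuts for monotone surjections: clipping the values\<close>

lemma double_G_maps:
  assumes "0 < L"
  shows "(\<lambda>t\<in>{0..L}. 2 * t) \<in> G_maps L (L + L)"
proof -
  have "(\<lambda>t\<in>{0..L}. (L + L) / L * t) = (\<lambda>t\<in>{0..L}. 2 * t)"
    using assms by (auto simp: fun_eq_iff)
  then show ?thesis
    using linear_G_maps[of L "L + L"] assms by simp
qed

definition clip_below :: "real \<Rightarrow> real \<Rightarrow> (real \<Rightarrow> real) \<Rightarrow> real \<Rightarrow> real" where
  "clip_below L a \<psi> = (\<lambda>t\<in>{0..L}. min (\<psi> t) a)"

definition clip_above :: "real \<Rightarrow> real \<Rightarrow> (real \<Rightarrow> real) \<Rightarrow> real \<Rightarrow> real" where
  "clip_above L a \<psi> = (\<lambda>t\<in>{0..L}. max (\<psi> t) a - a)"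

text \<open>At time \<open>u\<close> of the homotopy the first clipped map runs with speed \<open>1 + u\<close> until it stops at time
  \<open>L / (1 + u)\<close>, while the second one, with the same speed, starts at time
  \<open>u L / (1 + u)\<close>. For \<open>u = 0\<close> both follow \<open>\<psi>\<close>, and for \<open>u = 1\<close> the second starts when the first stops.\<close>
definition clip_path :: "real \<Rightarrow> real \<Rightarrow> real \<Rightarrow> (real \<Rightarrow> real) \<Rightarrow> real \<Rightarrow> real" where
  "clip_path L a u \<psi> = (\<lambda>t\<in>{0..L}.
     min (\<psi> (min ((1 + u) * t) L)) a + (max (\<psi> (max ((1 + u) * t - u * L) 0)) a - a))"

lemma scaled_time_bounds:
  assumes "0 \<le> u" "0 \<le> t" "t \<le> (L::real)"
  shows "0 \<le> (1 + u) * t" "(1 + u) * t - u * L \<le> t" "(1 + u) * t - u * L \<le> L" "t \<le> (1 + u) * t"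
  using assms mult_left_mono[of t L u] by (auto simp: algebra_simps)

lemma clip_M_maps:
  assumes pos: "0 < L" "0 < a" "0 < b" and \<psi>: "\<psi> \<in> M_maps L (a + b)"
  shows "clip_below L a \<psi> \<in> M_maps L a" "clip_above L a \<psi> \<in> M_maps L b"
proof -
  have "0 < a + b" using pos by simp
  note D = M_mapsD[OF pos(1) this \<psi>]
  have "continuous_on {0..L} (\<lambda>t. min (\<psi> t) a)"
    by (intro continuous_intros D(2))
  then have c1: "continuous_on {0..L} (clip_below L a \<psi>)"
    by (rule continuous_on_eq) (simp add: clip_below_def)
  have "continuous_on {0..L} (\<lambda>t. max (\<psi> t) a - a)"
    by (intro continuous_intros D(2))
  then have c2: "continuous_on {0..L} (clip_above L a \<psi>)"
    by (rule continuous_on_eq) (simp add: clip_above_def)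
  show "clip_below L a \<psi> \<in> M_maps L a"
    using pos D(3,4) c1 by (intro M_mapsI) (auto simp: clip_below_def min_le_iff_disj intro: D(5))
  show "clip_above L a \<psi> \<in> M_maps L b"
  proof (rule M_mapsI)
    fix s t assume "0 \<le> s" "s \<le> t" "t \<le> L"
    then show "clip_above L a \<psi> s \<le> clip_above L a \<psi> t"
      using D(5)[of s t] by (auto simp: clip_above_def)
  qed (use pos D(3,4) c2 in \<open>auto simp: clip_above_def\<close>)
qed

lemma clip_path_M_maps:
  assumes pos: "0 < L" "0 < a" "0 < b" and \<psi>: "\<psi> \<in> M_maps L (a + b)" and u: "0 \<le> u" "u \<le> 1"
  shows "clip_path L a u \<psi> \<in> M_maps L (a + b)"
proof (rule M_mapsI)
  show ab: "0 < a + b" using pos by simp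
  note D = M_mapsD[OF pos(1) ab \<psi>]
  have "continuous_on {0..L} (\<lambda>t. min (\<psi> (min ((1 + u) * t) L)) a
      + (max (\<psi> (max ((1 + u) * t - u * L) 0)) a - a))"
    by (intro continuous_intros continuous_on_compose2[OF D(2)])
       (use u pos in \<open>auto simp: scaled_time_bounds\<close>)
  then show "continuous_on {0..L} (clip_path L a u \<psi>)"
    unfolding clip_path_def by (rule continuous_on_eq) simp
  fix s t assume st: "0 \<le> s" "s \<le> t" "t \<le> L"
  then have "(1 + u) * s \<le> (1 + u) * t"
    using u by (intro mult_left_mono) auto
  moreover have "0 \<le> (1 + u) * s" "(1 + u) * t - u * L \<le> L"
    using scaled_time_bounds[of u s L] scaled_time_bounds[of u t L] st u by auto
  ultimately show "clip_path L a u \<psi> s \<le> clip_path L a u \<psi> t"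
    using st by (auto simp: clip_path_def intro!: add_mono min.mono max.mono diff_right_mono D(5))
next
  have "0 < a + b" using pos by simp
  note D = M_mapsD[OF pos(1) this \<psi>]
  show "clip_path L a u \<psi> 0 = 0"
    using pos u D(3) by (simp add: clip_path_def)
  show "clip_path L a u \<psi> L = a + b"
    using pos u D(4) by (simp add: clip_path_def algebra_simps)
qed (use pos in \<open>auto simp: clip_path_def\<close>)

text \<open>The tensor product maps the level \<open>a\<close> to the level \<open>a'\<close> and preserves the two sides of it, so it commutes with
  clipping.\<close>
lemma min_max_tensor:
  assumes "0 < a" "0 < a'" "0 < b" "0 < b'" "\<alpha> \<in> M_maps a a'" "\<beta> \<in> M_maps b b'" "0 \<le> t" "t \<le> a + b"
  shows "min (tensor a a' b b' \<alpha> \<beta> t) a' = \<alpha> (min t a)"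
    and "max (tensor a a' b b' \<alpha> \<beta> t) a' - a' = \<beta> (max t a - a)"
proof -
  note \<alpha> = M_mapsD[OF assms(1,2,5)] and \<beta> = M_mapsD[OF assms(3,4,6)]
  have e: "tensor a a' b b' \<alpha> \<beta> t = \<alpha> (min t a) + \<beta> (max t a - a)"
    using assms by (simp add: tensor_eq max_diff_distrib_left)
  show "min (tensor a a' b b' \<alpha> \<beta> t) a' = \<alpha> (min t a)"
    unfolding e using \<alpha>(4,7) \<beta>(3,6) assms by (cases "t \<le> a") auto
  show "max (tensor a a' b b' \<alpha> \<beta> t) a' - a' = \<beta> (max t a - a)"
    unfolding e using \<alpha>(4,7) \<beta>(3,6) assms by (cases "t \<le> a") auto
qed

text \<open>The first summand is evaluated at a later time \<open>p\<close> than the second one, at \<open>q\<close>. If the second is positive,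
  then \<open>\<psi> q > a\<close>, so \<open>\<psi> p > a\<close> and the first is \<open>a\<close>; hence \<open>tensor_add\<close> applies.\<close>
lemma clip_path_natural:
  assumes pos: "0 < L" "0 < a" "0 < a'" "0 < b" "0 < b'"
    and \<alpha>: "\<alpha> \<in> M_maps a a'" and \<beta>: "\<beta> \<in> M_maps b b'" and \<psi>: "\<psi> \<in> M_maps L (a + b)"
    and u: "0 \<le> u" "u \<le> 1"
  shows "clip_path L a' u (compose {0..L} (tensor a a' b b' \<alpha> \<beta>) \<psi>) =
    compose {0..L} (tensor a a' b b' \<alpha> \<beta>) (clip_path L a u \<psi>)"
proof (rule extensionalityI[of _ "{0..L}"])
  fix t assume t: "t \<in> {0..L}"
  define p q where "p = min ((1 + u) * t) L" and "q = max ((1 + u) * t - u * L) 0"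
  have pq: "0 \<le> p" "p \<le> L" "0 \<le> q" "q \<le> L" "q \<le> p"
    using t pos u scaled_time_bounds[of u t L] by (auto simp: p_def q_def)
  have "0 < a + b" using pos by simp
  note D = M_mapsD[OF pos(1) this \<psi>]
  have bd: "0 \<le> \<psi> p" "\<psi> p \<le> a + b" "0 \<le> \<psi> q" "\<psi> q \<le> a + b" "\<psi> q \<le> \<psi> p"
    using pq D(5,6,7) by auto
  have "tensor a a' b b' \<alpha> \<beta> (min (\<psi> p) a + (max (\<psi> q) a - a)) = \<alpha> (min (\<psi> p) a) + \<beta> (max (\<psi> q) a - a)"
    using bd pos by (intro tensor_add \<alpha> \<beta>) auto
  then show "clip_path L a' u (compose {0..L} (tensor a a' b b' \<alpha> \<beta>) \<psi>) t =
      compose {0..L} (tensor a a' b b' \<alpha> \<beta>) (clip_path L a u \<psi>) t"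
    using t pq bd
    by (simp add: clip_path_def compose_eq min_max_tensor pos \<alpha> \<beta> flip: p_def q_def)
qed (auto simp: clip_path_def)

lemma clip_path_1:
  assumes pos: "0 < L" "0 < a" "0 < b" and \<psi>: "\<psi> \<in> M_maps L (a + b)"
  shows "clip_path L a 1 \<psi> =
    compose {0..L} (tensor L a L b (clip_below L a \<psi>) (clip_above L a \<psi>)) (\<lambda>t\<in>{0..L}. 2 * t)"
proof (rule extensionalityI[of _ "{0..L}"])
  fix t assume t: "t \<in> {0..L}"
  have "\<psi> 0 = 0" "\<psi> L = a + b"
    using M_mapsD(3,4)[of L "a + b" \<psi>] pos \<psi> by auto
  then show "clip_path L a 1 \<psi> t = compose {0..L}
      (tensor L a L b (clip_below L a \<psi>) (clip_above L a \<psi>)) (\<lambda>t\<in>{0..L}. 2 * t) t"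
    using t pos by (cases "2 * t \<le> L")
      (auto simp: compose_eq tensor_def clip_path_def clip_below_def clip_above_def)
qed (auto simp: clip_path_def)

lemma has_cuts_\<M>:
  assumes Top: "Top = delta_generated \<or> Top = (\<lambda>X. delta_generated X \<and> delta_Hausdorff X)"
  shows "has_cuts Top \<M>"
proof -
  interpret R: reparametrization_category Top "interval_category M_maps"
    using Top by (rule M.reparametrization_category)
  have "cut_structure Top (interval_category M_maps) (\<lambda>L. \<lambda>t\<in>{0..L}. 2 * t)
      (\<lambda>L a b. clip_below L a) (\<lambda>L a b. clip_above L a) (\<lambda>L a b (u, \<psi>). clip_path L a u \<psi>)"
  proof unfold_locales
    fix L a b a' b' \<alpha> \<beta> \<psi>
    assume "L \<in> Obj M.P" "a \<in> Obj M.P" "a' \<in> Obj M.P" "b \<in> Obj M.P" "b' \<in> Obj M.P"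
      "\<alpha> \<in> topspace (Hom M.P a a')" "\<beta> \<in> topspace (Hom M.P b b')"
      "\<psi> \<in> topspace (Hom M.P L (Tobj M.P a b))"
    then have A: "0 < L" "0 < a" "0 < a'" "0 < b" "0 < b'" "\<alpha> \<in> M_maps a a'" "\<beta> \<in> M_maps b b'"
      "\<psi> \<in> M_maps L (a + b)"
      by (simp_all add: M.topspace_Hom)
    show "clip_below L a' (Comp M.P L (Tobj M.P a b) (Tobj M.P a' b') (Tmor M.P a a' b b' \<alpha> \<beta>) \<psi>) =
        Comp M.P L a a' \<alpha> (clip_below L a \<psi>)"
      using A M_mapsD(6,7)[of L "a + b" \<psi>]
      by (intro extensionalityI[of _ "{0..L}"]) (auto simp: clip_below_def compose_eq min_max_tensor)
    show "clip_above L a' (Comp M.P L (Tobj M.P a b) (Tobj M.P a' b') (Tmor M.P a a' b b' \<alpha> \<beta>) \<psi>) =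
        Comp M.P L b b' \<beta> (clip_above L a \<psi>)"
      using A M_mapsD(6,7)[of L "a + b" \<psi>]
      by (intro extensionalityI[of _ "{0..L}"]) (auto simp: clip_above_def compose_eq min_max_tensor)
    fix u :: real assume "u \<in> {0..1}"
    then show "(case (u, Comp M.P L (Tobj M.P a b) (Tobj M.P a' b') (Tmor M.P a a' b b' \<alpha> \<beta>) \<psi>) of
          (u, \<psi>) \<Rightarrow> clip_path L a' u \<psi>) =
        Comp M.P L (Tobj M.P a b) (Tobj M.P a' b') (Tmor M.P a a' b b' \<alpha> \<beta>)
          (case (u, \<psi>) of (u, \<psi>) \<Rightarrow> clip_path L a u \<psi>)"
      using A by (simp add: clip_path_natural)
  next
    fix L assume "L \<in> Obj M.P"
    then show "(\<lambda>t\<in>{0..L}. 2 * t) \<in> topspace (Hom M.P L (Tobj M.P L L))"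
      using double_G_maps[of L] G_maps_subset_M_maps[of L "L + L"] by (auto simp: M.topspace_Hom)
  next
    fix L a b assume "L \<in> Obj M.P" "a \<in> Obj M.P" "b \<in> Obj M.P"
    then have A: "0 < L" "0 < a" "0 < b" "0 < a + b" by simp_all
    show "continuous_map (Hom M.P L (Tobj M.P a b)) (Hom M.P L a) (clip_below L a)"
      unfolding interval_category_simps
    proof (rule M.continuous_map_Hom_HomI)
      fix S :: "(nat \<Rightarrow> real) set" and \<phi> :: "(nat \<Rightarrow> real) \<Rightarrow> real \<Rightarrow> real"
      assume "continuous_on (S \<times> {0..L}) (\<lambda>p. \<phi> (fst p) (snd p))"
      then have "continuous_on (S \<times> {0..L}) (\<lambda>p. min (\<phi> (fst p) (snd p)) a)"
        by (intro continuous_intros)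
      then show "continuous_on (S \<times> {0..L}) (\<lambda>p. clip_below L a (\<phi> (fst p)) (snd p))"
        by (rule continuous_on_eq) (auto simp: clip_below_def)
    qed (use A clip_M_maps in auto)
    show "continuous_map (Hom M.P L (Tobj M.P a b)) (Hom M.P L b) (clip_above L a)"
      unfolding interval_category_simps
    proof (rule M.continuous_map_Hom_HomI)
      fix S :: "(nat \<Rightarrow> real) set" and \<phi> :: "(nat \<Rightarrow> real) \<Rightarrow> real \<Rightarrow> real"
      assume "continuous_on (S \<times> {0..L}) (\<lambda>p. \<phi> (fst p) (snd p))"
      then have "continuous_on (S \<times> {0..L}) (\<lambda>p. max (\<phi> (fst p) (snd p)) a - a)"
        by (intro continuous_intros)
      then show "continuous_on (S \<times> {0..L}) (\<lambda>p. clip_above L a (\<phi> (fst p)) (snd p))"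
        by (rule continuous_on_eq) (auto simp: clip_above_def)
    qed (use A clip_M_maps in auto)
    show "continuous_map (Top_prod (top_of_set {0..1}) (Hom M.P L (Tobj M.P a b)))
        (Hom M.P L (Tobj M.P a b)) (\<lambda>(u, \<psi>). clip_path L a u \<psi>)"
      unfolding interval_category_simps
    proof (rule M.continuous_map_homotopy_HomI)
      fix S :: "(nat \<Rightarrow> real) set" and \<upsilon> :: "(nat \<Rightarrow> real) \<Rightarrow> real" and \<phi> :: "(nat \<Rightarrow> real) \<Rightarrow> real \<Rightarrow> real"
      assume u: "\<And>z. z \<in> S \<Longrightarrow> 0 \<le> \<upsilon> z \<and> \<upsilon> z \<le> 1" "continuous_on S \<upsilon>"
        and \<phi>: "continuous_on (S \<times> {0..L}) (\<lambda>p. \<phi> (fst p) (snd p))"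
      have u': "continuous_on (S \<times> {0..L}) (\<lambda>p. \<upsilon> (fst p))"
        by (intro continuous_on_compose2[OF u(2)] continuous_intros) auto
      have "continuous_on (S \<times> {0..L}) (\<lambda>p. min (\<phi> (fst p) (min ((1 + \<upsilon> (fst p)) * snd p) L)) a
          + (max (\<phi> (fst p) (max ((1 + \<upsilon> (fst p)) * snd p - \<upsilon> (fst p) * L) 0)) a - a))"
        by (intro continuous_on_add continuous_on_diff continuous_on_min continuous_on_max
            continuous_on_family_compose[OF \<phi>] continuous_on_const continuous_on_mult continuous_on_fst
            continuous_on_snd continuous_on_id u')
           (use A u(1) in \<open>auto simp: scaled_time_bounds\<close>)
      then show "continuous_on (S \<times> {0..L}) (\<lambda>p. clip_path L a (\<upsilon> (fst p)) (\<phi> (fst p)) (snd p))"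
        by (rule continuous_on_eq) (auto simp: clip_path_def)
    qed (use A clip_path_M_maps in auto)
    fix \<psi> assume "\<psi> \<in> topspace (Hom M.P L (Tobj M.P a b))"
    then have \<psi>: "\<psi> \<in> M_maps L (a + b)"
      using A by (simp add: M.topspace_Hom)
    show "(case (0, \<psi>) of (u, \<psi>) \<Rightarrow> clip_path L a u \<psi>) = \<psi>"
      using A M_mapsD(1)[OF _ _ \<psi>]
      by (intro extensionalityI[of _ "{0..L}"]) (auto simp: clip_path_def)
    show "(case (1, \<psi>) of (u, \<psi>) \<Rightarrow> clip_path L a u \<psi>) =
        Comp M.P L (Tobj M.P L L) (Tobj M.P a b)
          (Tmor M.P L a L b (clip_below L a \<psi>) (clip_above L a \<psi>)) (\<lambda>t\<in>{0..L}. 2 * t)"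
      using clip_path_1[OF A(1-3) \<psi>] by simp
  qed
  then show ?thesis
    unfolding has_cuts_def \<M>_def by blast
qed

section \<open>Cuts for homeomorphisms: cutting the time\<close>
definition crossing :: "real \<Rightarrow> real \<Rightarrow> (real \<Rightarrow> real) \<Rightarrow> real" where
  "crossing L a \<psi> = the_inv_into {0..L} \<psi> a"

lemma crossing_props:
  assumes pos: "0 < L" "0 < a" "0 < b" and \<psi>: "\<psi> \<in> G_maps L (a + b)"
  shows "0 < crossing L a \<psi>" "crossing L a \<psi> < L" "\<psi> (crossing L a \<psi>) = a"
proof -
  have \<psi>': "\<psi> \<in> M_maps L (a + b)" and inj: "inj_on \<psi> {0..L}"
    using \<psi> pos strict_mono_on_imp_inj_on by (auto simp: G_maps_iff)
  obtain s where "0 < s" "s < L" "\<psi> s = a"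
    using M_maps_split[OF pos \<psi>'] by blast
  moreover from this have "crossing L a \<psi> = s"
    unfolding crossing_def by (intro the_inv_into_f_eq inj) auto
  ultimately show "0 < crossing L a \<psi>" "crossing L a \<psi> < L" "\<psi> (crossing L a \<psi>) = a"
    by auto
qed

lemma crossing_unique:
  assumes "0 < L" "0 < m" "\<psi> \<in> G_maps L m" "0 \<le> s" "s \<le> L" "\<psi> s = a"
  shows "crossing L a \<psi> = s"
  unfolding crossing_def
  using assms strict_mono_on_imp_inj_on by (intro the_inv_into_f_eq) (auto simp: G_maps_iff)

text \<open>The point \<open>a\<close> is sent to \<open>a'\<close>, so the time at which \<open>\<psi>\<close> reaches the cutting level is unchanged.\<close>
lemma crossing_natural:
  assumes pos: "0 < L" "0 < a" "0 < a'" "0 < b" "0 < b'"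
    and \<alpha>: "\<alpha> \<in> G_maps a a'" and \<beta>: "\<beta> \<in> G_maps b b'" and \<psi>: "\<psi> \<in> G_maps L (a + b)"
  shows "crossing L a' (compose {0..L} (tensor a a' b b' \<alpha> \<beta>) \<psi>) = crossing L a \<psi>"
proof (rule crossing_unique)
  note s = crossing_props[OF pos(1,2,4) \<psi>]
  show "compose {0..L} (tensor a a' b b' \<alpha> \<beta>) \<psi> \<in> G_maps L (a' + b')"
    by (rule compose_G_maps[OF _ _ _ \<psi>]) (use pos tensor_G_maps \<alpha> \<beta> in auto)
  show "compose {0..L} (tensor a a' b b' \<alpha> \<beta>) \<psi> (crossing L a \<psi>) = a'"
    using s pos \<alpha> M_mapsD(4)[of a a' \<alpha>] by (simp add: compose_eq tensor_def G_maps_iff)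
qed (use crossing_props[OF pos(1,2,4) \<psi>] pos in auto)

text \<open>Monotonicity replaces the implicit function theorem: the crossing time exceeds \<open>c\<close> iff the value at time
  \<open>c\<close> is below \<open>a\<close>, which is an open condition, and symmetrically from above.\<close>
lemma continuous_on_crossing:
  fixes S :: "'a::topological_space set"
  assumes pos: "0 < L" "0 < a" "0 < b" and \<phi>: "\<And>z. z \<in> S \<Longrightarrow> \<phi> z \<in> G_maps L (a + b)"
    and cont: "continuous_on (S \<times> {0..L}) (\<lambda>p. \<phi> (fst p) (snd p))"
  shows "continuous_on S (\<lambda>z. crossing L a (\<phi> z))"
  unfolding continuous_on_def
proof (intro ballI order_tendstoI)
  fix z0 c assume z0: "z0 \<in> S"
  note s = crossing_props[OF pos \<phi>]
  have less: "\<phi> z x < \<phi> z y" if "z \<in> S" "0 \<le> x" "x < y" "y \<le> L" for z x y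
    using G_maps_strict[OF _ _ \<phi>[OF that(1)]] that pos by simp
  have in_S: "eventually (\<lambda>z. z \<in> S) (at z0 within S)"
    by (simp add: eventually_at_filter)
  have lim: "((\<lambda>z. \<phi> z c) \<longlongrightarrow> \<phi> z0 c) (at z0 within S)" if "0 \<le> c" "c \<le> L"
  proof -
    have "continuous_on S (\<lambda>z. \<phi> z c)"
      by (intro continuous_on_family_compose[OF cont] continuous_intros) (use that in auto)
    then show ?thesis
      using z0 by (simp add: continuous_on_def)
  qed
  show "\<forall>\<^sub>F z in at z0 within S. c < crossing L a (\<phi> z)" if c: "c < crossing L a (\<phi> z0)"
  proof (cases "0 \<le> c")
    case True
    then have "\<phi> z0 c < a" "c \<le> L"
      using less[OF z0 True c] s[OF z0] c by auto
    then have "\<forall>\<^sub>F z in at z0 within S. \<phi> z c < a"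
      using order_tendstoD(2)[OF lim] True by blast
    then show ?thesis
      using in_S
    proof eventually_elim
      case (elim z)
      show ?case
      proof (rule ccontr)
        assume "\<not> c < crossing L a (\<phi> z)"
        then have "a \<le> \<phi> z c"
          using less[of z "crossing L a (\<phi> z)" c] s[of z] elim \<open>c \<le> L\<close>
          by (cases "c = crossing L a (\<phi> z)") auto
        with elim show False by simp
      qed
    qed
  next
    case False
    show ?thesis
      using in_S by eventually_elim (use s False in force)
  qed
  show "\<forall>\<^sub>F z in at z0 within S. crossing L a (\<phi> z) < c" if c: "crossing L a (\<phi> z0) < c"
  proof (cases "c \<le> L")
    case True
    then have "a < \<phi> z0 c" "0 \<le> c"
      using less[OF z0 _ c True] s[OF z0] c by auto
    then have "\<forall>\<^sub>F z in at z0 within S. a < \<phi> z c"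
      using order_tendstoD(1)[OF lim] True by blast
    then show ?thesis
      using in_S
    proof eventually_elim
      case (elim z)
      show ?case
      proof (rule ccontr)
        assume "\<not> crossing L a (\<phi> z) < c"
        then have "\<phi> z c \<le> a"
          using less[of z c "crossing L a (\<phi> z)"] s[of z] elim \<open>0 \<le> c\<close>
          by (cases "c = crossing L a (\<phi> z)") auto
        with elim show False by simp
      qed
    qed
  next
    case False
    show ?thesis
      using in_S by eventually_elim (use s False in force)
  qed
qed

corollary continuous_on_crossing_fst:
  fixes S :: "'a::topological_space set" and T :: "'b::topological_space set"
  assumes "0 < L" "0 < a" "0 < b" "\<And>z. z \<in> S \<Longrightarrow> \<phi> z \<in> G_maps L (a + b)"
    "continuous_on (S \<times> {0..L}) (\<lambda>p. \<phi> (fst p) (snd p))"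
  shows "continuous_on (S \<times> T) (\<lambda>p. crossing L a (\<phi> (fst p)))"
  by (rule continuous_on_compose2[OF continuous_on_crossing[OF assms]
      continuous_on_fst[OF continuous_on_id]]) auto

definition cut_left :: "real \<Rightarrow> real \<Rightarrow> (real \<Rightarrow> real) \<Rightarrow> real \<Rightarrow> real" where
  "cut_left L a \<psi> = (\<lambda>t\<in>{0..L}. \<psi> (crossing L a \<psi> / L * t))"

definition cut_right :: "real \<Rightarrow> real \<Rightarrow> (real \<Rightarrow> real) \<Rightarrow> real \<Rightarrow> real" where
  "cut_right L a \<psi> = (\<lambda>t\<in>{0..L}. \<psi> (crossing L a \<psi> + (L - crossing L a \<psi>) / L * t) - a)"

text \<open>The piecewise affine map of \<open>[0, L]\<close> that sends \<open>L / 2\<close> to \<open>s\<close> and fixes both ends.\<close>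
definition bend :: "real \<Rightarrow> real \<Rightarrow> real \<Rightarrow> real" where
  "bend L s t = s / L * min (2 * t) L + (L - s) / L * max (2 * t - L) 0"

definition bend_path :: "real \<Rightarrow> real \<Rightarrow> real \<Rightarrow> (real \<Rightarrow> real) \<Rightarrow> real \<Rightarrow> real" where
  "bend_path L a u \<psi> = compose {0..L} \<psi> (\<lambda>t\<in>{0..L}. (1 - u) * t + u * bend L (crossing L a \<psi>) t)"

lemma affine_bounds:
  assumes "0 < s" "s < (L::real)" "0 \<le> t" "t \<le> L"
  shows "0 \<le> s / L * t" "s / L * t \<le> s" "0 \<le> (L - s) / L * t" "s + (L - s) / L * t \<le> L"
proof -
  have t: "0 \<le> t / L" "t / L \<le> 1"
    using assms by auto
  then have "s * (t / L) \<le> s" "(L - s) * (t / L) \<le> L - s"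
    using assms by (auto intro: mult_left_le simp del: times_divide_eq_right)
  moreover have "0 \<le> s * (t / L)" "0 \<le> (L - s) * (t / L)"
    using assms t by (auto simp del: times_divide_eq_right)
  ultimately show "0 \<le> s / L * t" "s / L * t \<le> s" "0 \<le> (L - s) / L * t" "s + (L - s) / L * t \<le> L"
    by simp_all
qed

lemma bend_strict_mono:
  assumes "0 < s" "s < L" "t < t'"
  shows "bend L s t < bend L s t'"
proof -
  have pos: "0 < s / L" "0 < (L - s) / L" using assms by auto
  show ?thesis
  proof (cases "2 * t < L")
    case True
    then have "s / L * min (2 * t) L < s / L * min (2 * t') L"
      using assms pos by (intro mult_strict_left_mono) auto
    moreover have "(L - s) / L * max (2 * t - L) 0 \<le> (L - s) / L * max (2 * t' - L) 0"
      using assms pos by (intro mult_left_mono) auto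
    ultimately show ?thesis by (simp only: bend_def)
  next
    case False
    then have "(L - s) / L * max (2 * t - L) 0 < (L - s) / L * max (2 * t' - L) 0"
      using assms pos by (intro mult_strict_left_mono) auto
    then show ?thesis using False assms by (simp add: bend_def)
  qed
qed

lemma bend_G_maps:
  assumes "0 < s" "s < L" "0 \<le> u" "u \<le> 1"
  shows "(\<lambda>t\<in>{0..L}. (1 - u) * t + u * bend L s t) \<in> G_maps L L"
proof (rule G_mapsI)
  have "continuous_on {0..L} (\<lambda>t. (1 - u) * t + u * bend L s t)"
    unfolding bend_def using assms by (intro continuous_intros) auto
  then show "continuous_on {0..L} (\<lambda>t\<in>{0..L}. (1 - u) * t + u * bend L s t)"
    by (rule continuous_on_eq) simp
  fix t t' assume t: "0 \<le> t" "t < t'" "t' \<le> L"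
  have "(1 - u) * t + u * bend L s t < (1 - u) * t' + u * bend L s t'"
  proof (cases "u = 0")
    case False
    then have "u * bend L s t < u * bend L s t'"
      using bend_strict_mono[OF assms(1,2) t(2)] assms by (intro mult_strict_left_mono) auto
    moreover have "(1 - u) * t \<le> (1 - u) * t'"
      using t assms by (intro mult_left_mono) auto
    ultimately show ?thesis by linarith
  qed (use t in simp)
  with t show "(\<lambda>t\<in>{0..L}. (1 - u) * t + u * bend L s t) t < (\<lambda>t\<in>{0..L}. (1 - u) * t + u * bend L s t) t'"
    by simp
qed (use assms in \<open>auto simp: bend_def field_simps\<close>)

lemma cut_G_maps:
  assumes pos: "0 < L" "0 < a" "0 < b" and \<psi>: "\<psi> \<in> G_maps L (a + b)"
  shows "cut_left L a \<psi> \<in> G_maps L a" "cut_right L a \<psi> \<in> G_maps L b"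
proof -
  define s where "s = crossing L a \<psi>"
  have s: "0 < s" "s < L" "\<psi> s = a"
    using crossing_props[OF pos \<psi>] by (simp_all add: s_def)
  have \<psi>': "\<psi> \<in> M_maps L (a + b)" and ab: "0 < a + b"
    using \<psi> pos by (auto simp: G_maps_iff)
  note D = M_mapsD[OF pos(1) ab \<psi>'] and bd = affine_bounds[OF s(1,2)]
  note less = G_maps_strict[OF pos(1) ab \<psi>]
  show "cut_left L a \<psi> \<in> G_maps L a"
  proof (rule G_mapsI)
    have "continuous_on {0..L} (\<lambda>t. \<psi> (s / L * t))"
      by (intro continuous_on_compose2[OF D(2)] continuous_on_mult continuous_on_const continuous_on_id)
         (use bd s in \<open>force\<close>)
    then show "continuous_on {0..L} (cut_left L a \<psi>)"
      by (rule continuous_on_eq) (simp add: cut_left_def s_def)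
    fix t t' assume t: "0 \<le> t" "t < t'" "t' \<le> L"
    have "s / L * t < s / L * t'"
      using s pos t by (intro mult_strict_left_mono) auto
    then have "\<psi> (s / L * t) < \<psi> (s / L * t')"
      using t s bd(1)[of t] bd(2)[of t'] by (intro less) auto
    then show "cut_left L a \<psi> t < cut_left L a \<psi> t'"
      using t by (simp add: cut_left_def s_def)
  qed (use pos s D in \<open>auto simp: cut_left_def simp flip: s_def\<close>)
  show "cut_right L a \<psi> \<in> G_maps L b"
  proof (rule G_mapsI)
    have "continuous_on {0..L} (\<lambda>t. \<psi> (s + (L - s) / L * t) - a)"
      by (intro continuous_on_diff continuous_on_compose2[OF D(2)] continuous_on_mult
          continuous_on_add continuous_on_const continuous_on_id)
         (use bd s in \<open>force\<close>)
    then show "continuous_on {0..L} (cut_right L a \<psi>)"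
      by (rule continuous_on_eq) (simp add: cut_right_def s_def)
    fix t t' assume t: "0 \<le> t" "t < t'" "t' \<le> L"
    have "(L - s) / L * t < (L - s) / L * t'"
      using s pos t by (intro mult_strict_left_mono) auto
    then have "\<psi> (s + (L - s) / L * t) < \<psi> (s + (L - s) / L * t')"
      using t s bd(3)[of t] bd(4)[of t'] by (intro less) auto
    then show "cut_right L a \<psi> t < cut_right L a \<psi> t'"
      using t by (simp add: cut_right_def s_def)
  qed (use pos s D in \<open>auto simp: cut_right_def simp flip: s_def\<close>)
qed

text \<open>Both sides use the same crossing time, and before it \<open>\<psi>\<close> takes values in \<open>[0, a]\<close>, where the tensor product
  is \<open>\<alpha>\<close>; after it, it is the shifted \<open>\<beta>\<close>.\<close>
lemma cut_natural:
  assumes pos: "0 < L" "0 < a" "0 < a'" "0 < b" "0 < b'"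
    and \<alpha>: "\<alpha> \<in> G_maps a a'" and \<beta>: "\<beta> \<in> G_maps b b'" and \<psi>: "\<psi> \<in> G_maps L (a + b)"
  shows "cut_left L a' (compose {0..L} (tensor a a' b b' \<alpha> \<beta>) \<psi>) = compose {0..L} \<alpha> (cut_left L a \<psi>)"
    and "cut_right L a' (compose {0..L} (tensor a a' b b' \<alpha> \<beta>) \<psi>) = compose {0..L} \<beta> (cut_right L a \<psi>)"
proof -
  define s where "s = crossing L a \<psi>"
  have s: "0 < s" "s < L" "\<psi> s = a"
    using crossing_props[OF pos(1,2,4) \<psi>] by (simp_all add: s_def)
  note nat = crossing_natural[OF assms, folded s_def]
  have M: "\<alpha> \<in> M_maps a a'" "\<beta> \<in> M_maps b b'" "\<psi> \<in> M_maps L (a + b)" "0 < a + b"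
    using pos \<alpha> \<beta> \<psi> by (simp_all add: G_maps_iff)
  note D = M_mapsD[OF pos(1) M(4,3)]
  let ?\<chi> = "compose {0..L} (tensor a a' b b' \<alpha> \<beta>) \<psi>"
  show "cut_left L a' ?\<chi> = compose {0..L} \<alpha> (cut_left L a \<psi>)"
  proof (rule extensionalityI[of _ "{0..L}"])
    fix t assume t: "t \<in> {0..L}"
    define r where "r = s / L * t"
    have r: "0 \<le> r" "r \<le> s" "r \<in> {0..L}"
      using affine_bounds[of s L t] s t by (auto simp: r_def)
    have "cut_left L a' ?\<chi> t = ?\<chi> r" "cut_left L a \<psi> t = \<psi> r"
      using t by (simp_all only: cut_left_def restrict_apply' nat r_def s_def)
    moreover have "tensor a a' b b' \<alpha> \<beta> (\<psi> r) = \<alpha> (\<psi> r)"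
      using tensor_add[OF pos(2-5) M(1,2), of "\<psi> r" 0] D(5)[of r s] D(6)[of r] r s pos
        M_mapsD(3)[OF pos(4,5) M(2)]
      by simp
    ultimately show "cut_left L a' ?\<chi> t = compose {0..L} \<alpha> (cut_left L a \<psi>) t"
      using t r by (simp only: compose_eq)
  qed (auto simp: cut_left_def)
  show "cut_right L a' ?\<chi> = compose {0..L} \<beta> (cut_right L a \<psi>)"
  proof (rule extensionalityI[of _ "{0..L}"])
    fix t assume t: "t \<in> {0..L}"
    define r where "r = s + (L - s) / L * t"
    have "0 \<le> (L - s) / L * t" "s + (L - s) / L * t \<le> L"
      using affine_bounds(3,4)[OF s(1,2)] t by simp_all
    then have "s \<le> r" "r \<le> L"
      unfolding r_def by linarith+
    then have r: "a \<le> \<psi> r" "\<psi> r \<le> a + b" "r \<in> {0..L}"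
      using D(5)[of s r] D(7)[of r] s by auto
    have "cut_right L a' ?\<chi> t = ?\<chi> r - a'" "cut_right L a \<psi> t = \<psi> r - a"
      using t by (simp_all only: cut_right_def restrict_apply' nat r_def s_def)
    moreover have "tensor a a' b b' \<alpha> \<beta> (a + (\<psi> r - a)) = \<alpha> a + \<beta> (\<psi> r - a)"
      using r pos by (intro tensor_add M) auto
    then have "tensor a a' b b' \<alpha> \<beta> (\<psi> r) - a' = \<beta> (\<psi> r - a)"
      using M_mapsD(4)[OF pos(2,3) M(1)] by simp
    ultimately show "cut_right L a' ?\<chi> t = compose {0..L} \<beta> (cut_right L a \<psi>) t"
      using t r by (simp only: compose_eq)
  qed (auto simp: cut_right_def)
qed

text \<open>The change of time depends only on the crossing time, and precomposition commutes with postcomposition.\<close>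
lemma bend_path_natural:
  assumes pos: "0 < L" "0 < a" "0 < a'" "0 < b" "0 < b'"
    and \<alpha>: "\<alpha> \<in> G_maps a a'" and \<beta>: "\<beta> \<in> G_maps b b'" and \<psi>: "\<psi> \<in> G_maps L (a + b)"
    and u: "0 \<le> u" "u \<le> 1"
  shows "bend_path L a' u (compose {0..L} (tensor a a' b b' \<alpha> \<beta>) \<psi>) =
    compose {0..L} (tensor a a' b b' \<alpha> \<beta>) (bend_path L a u \<psi>)"
proof -
  let ?r = "\<lambda>t\<in>{0..L}. (1 - u) * t + u * bend L (crossing L a \<psi>) t"
  have "?r \<in> M_maps L L"
    using bend_G_maps crossing_props[OF pos(1,2,4) \<psi>] u pos(1) G_maps_subset_M_maps[of L L] by blast
  then have "?r \<in> {0..L} \<rightarrow> {0..L}"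
    by (auto simp: M_maps_def simp del: restrict_apply)
  then show ?thesis
    unfolding bend_path_def crossing_natural[OF assms(1-8)]
    by (rule compose_assoc[symmetric])
qed

lemma bend_path_G_maps:
  assumes pos: "0 < L" "0 < a" "0 < b" and \<psi>: "\<psi> \<in> G_maps L (a + b)" and u: "0 \<le> u" "u \<le> 1"
  shows "bend_path L a u \<psi> \<in> G_maps L (a + b)"
  unfolding bend_path_def
  by (rule compose_G_maps[OF _ _ _ bend_G_maps \<psi>]) (use pos u crossing_props[OF pos \<psi>] in auto)

lemma bend_path_1:
  assumes pos: "0 < L" "0 < a" "0 < b" and \<psi>: "\<psi> \<in> G_maps L (a + b)"
  shows "bend_path L a 1 \<psi> =
    compose {0..L} (tensor L a L b (cut_left L a \<psi>) (cut_right L a \<psi>)) (\<lambda>t\<in>{0..L}. 2 * t)"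
proof (rule extensionalityI[of _ "{0..L}"])
  define s where "s = crossing L a \<psi>"
  have s: "0 < s" "s < L" "\<psi> s = a"
    using crossing_props[OF pos \<psi>] by (simp_all add: s_def)
  fix t assume "t \<in> {0..L}"
  then show "bend_path L a 1 \<psi> t = compose {0..L}
      (tensor L a L b (cut_left L a \<psi>) (cut_right L a \<psi>)) (\<lambda>t\<in>{0..L}. 2 * t) t"
    using s by (cases "2 * t \<le> L")
      (auto simp: bend_path_def bend_def compose_eq tensor_def cut_left_def cut_right_def min_def max_def
        simp flip: s_def)
qed (auto simp: bend_path_def)

lemma has_cuts_\<G>:
  assumes Top: "Top = delta_generated \<or> Top = (\<lambda>X. delta_generated X \<and> delta_Hausdorff X)"
  shows "has_cuts Top \<G>"
proof -
  interpret R: reparametrization_category Top "interval_category G_maps"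
    using Top by (rule G.reparametrization_category)
  have "cut_structure Top (interval_category G_maps) (\<lambda>L. \<lambda>t\<in>{0..L}. 2 * t)
      (\<lambda>L a b. cut_left L a) (\<lambda>L a b. cut_right L a) (\<lambda>L a b (u, \<psi>). bend_path L a u \<psi>)"
  proof unfold_locales
    fix L a b a' b' \<alpha> \<beta> \<psi>
    assume "L \<in> Obj G.P" "a \<in> Obj G.P" "a' \<in> Obj G.P" "b \<in> Obj G.P" "b' \<in> Obj G.P"
      "\<alpha> \<in> topspace (Hom G.P a a')" "\<beta> \<in> topspace (Hom G.P b b')"
      "\<psi> \<in> topspace (Hom G.P L (Tobj G.P a b))"
    then have A: "0 < L" "0 < a" "0 < a'" "0 < b" "0 < b'" "\<alpha> \<in> G_maps a a'" "\<beta> \<in> G_maps b b'"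
      "\<psi> \<in> G_maps L (a + b)"
      by (simp_all add: G.topspace_Hom)
    show "cut_left L a' (Comp G.P L (Tobj G.P a b) (Tobj G.P a' b') (Tmor G.P a a' b b' \<alpha> \<beta>) \<psi>) =
        Comp G.P L a a' \<alpha> (cut_left L a \<psi>)"
      using cut_natural(1)[OF A] by simp
    show "cut_right L a' (Comp G.P L (Tobj G.P a b) (Tobj G.P a' b') (Tmor G.P a a' b b' \<alpha> \<beta>) \<psi>) =
        Comp G.P L b b' \<beta> (cut_right L a \<psi>)"
      using cut_natural(2)[OF A] by simp
    fix u :: real assume "u \<in> {0..1}"
    then show "(case (u, Comp G.P L (Tobj G.P a b) (Tobj G.P a' b') (Tmor G.P a a' b b' \<alpha> \<beta>) \<psi>) of
          (u, \<psi>) \<Rightarrow> bend_path L a' u \<psi>) =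
        Comp G.P L (Tobj G.P a b) (Tobj G.P a' b') (Tmor G.P a a' b b' \<alpha> \<beta>)
          (case (u, \<psi>) of (u, \<psi>) \<Rightarrow> bend_path L a u \<psi>)"
      using A by (simp add: bend_path_natural)
  next
    fix L assume "L \<in> Obj G.P"
    then show "(\<lambda>t\<in>{0..L}. 2 * t) \<in> topspace (Hom G.P L (Tobj G.P L L))"
      using double_G_maps[of L] by (simp add: G.topspace_Hom)
  next
    fix L a b assume "L \<in> Obj G.P" "a \<in> Obj G.P" "b \<in> Obj G.P"
    then have A: "0 < L" "0 < a" "0 < b" "0 < a + b" by simp_all
    show "continuous_map (Hom G.P L (Tobj G.P a b)) (Hom G.P L a) (cut_left L a)"
      unfolding interval_category_simps
    proof (rule G.continuous_map_Hom_HomI)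
      fix S :: "(nat \<Rightarrow> real) set" and \<phi> :: "(nat \<Rightarrow> real) \<Rightarrow> real \<Rightarrow> real"
      assume \<phi>: "\<And>z. z \<in> S \<Longrightarrow> \<phi> z \<in> G_maps L (a + b)"
        "continuous_on (S \<times> {0..L}) (\<lambda>p. \<phi> (fst p) (snd p))"
      note s = crossing_props[OF A(1-3) \<phi>(1)]
      have c: "continuous_on (S \<times> {0..L}) (\<lambda>p. crossing L a (\<phi> (fst p)))"
        by (rule continuous_on_crossing_fst[OF A(1-3) \<phi>])
      have "continuous_on (S \<times> {0..L}) (\<lambda>p. \<phi> (fst p) (crossing L a (\<phi> (fst p)) / L * snd p))"
      proof (rule continuous_on_family_compose[OF \<phi>(2)])
        fix p assume "p \<in> S \<times> {0..L}"
        then show "crossing L a (\<phi> (fst p)) / L * snd p \<in> {0..L}"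
          using affine_bounds[of "crossing L a (\<phi> (fst p))" L "snd p"] s[of "fst p"] by auto
      qed (use A(1) in \<open>auto intro!: continuous_on_add continuous_on_diff continuous_on_mult continuous_on_divide
          continuous_on_min continuous_on_max continuous_on_const continuous_on_fst continuous_on_snd continuous_on_id c\<close>)
      then show "continuous_on (S \<times> {0..L}) (\<lambda>p. cut_left L a (\<phi> (fst p)) (snd p))"
        by (rule continuous_on_eq) (auto simp: cut_left_def)
    qed (use A cut_G_maps in auto)
    show "continuous_map (Hom G.P L (Tobj G.P a b)) (Hom G.P L b) (cut_right L a)"
      unfolding interval_category_simps
    proof (rule G.continuous_map_Hom_HomI)
      fix S :: "(nat \<Rightarrow> real) set" and \<phi> :: "(nat \<Rightarrow> real) \<Rightarrow> real \<Rightarrow> real"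
      assume \<phi>: "\<And>z. z \<in> S \<Longrightarrow> \<phi> z \<in> G_maps L (a + b)"
        "continuous_on (S \<times> {0..L}) (\<lambda>p. \<phi> (fst p) (snd p))"
      note s = crossing_props[OF A(1-3) \<phi>(1)]
      have c: "continuous_on (S \<times> {0..L}) (\<lambda>p. crossing L a (\<phi> (fst p)))"
        by (rule continuous_on_crossing_fst[OF A(1-3) \<phi>])
      have "continuous_on (S \<times> {0..L}) (\<lambda>p. \<phi> (fst p)
          (crossing L a (\<phi> (fst p)) + (L - crossing L a (\<phi> (fst p))) / L * snd p))"
      proof (rule continuous_on_family_compose[OF \<phi>(2)])
        fix p assume "p \<in> S \<times> {0..L}"
        then show "crossing L a (\<phi> (fst p)) + (L - crossing L a (\<phi> (fst p))) / L * snd p \<in> {0..L}"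
          using affine_bounds[of "crossing L a (\<phi> (fst p))" L "snd p"] s[of "fst p"] by auto
      qed (use A(1) in \<open>auto intro!: continuous_on_add continuous_on_diff continuous_on_mult continuous_on_divide
          continuous_on_min continuous_on_max continuous_on_const continuous_on_fst continuous_on_snd continuous_on_id c\<close>)
      from continuous_on_diff[OF this continuous_on_const[of _ a]]
      show "continuous_on (S \<times> {0..L}) (\<lambda>p. cut_right L a (\<phi> (fst p)) (snd p))"
        by (rule continuous_on_eq) (auto simp: cut_right_def)
    qed (use A cut_G_maps in auto)
    show "continuous_map (Top_prod (top_of_set {0..1}) (Hom G.P L (Tobj G.P a b)))
        (Hom G.P L (Tobj G.P a b)) (\<lambda>(u, \<psi>). bend_path L a u \<psi>)"
      unfolding interval_category_simps
    proof (rule G.continuous_map_homotopy_HomI)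
      fix S :: "(nat \<Rightarrow> real) set" and \<upsilon> :: "(nat \<Rightarrow> real) \<Rightarrow> real" and \<phi> :: "(nat \<Rightarrow> real) \<Rightarrow> real \<Rightarrow> real"
      assume u: "\<And>z. z \<in> S \<Longrightarrow> 0 \<le> \<upsilon> z \<and> \<upsilon> z \<le> 1" "continuous_on S \<upsilon>"
        and \<phi>: "\<And>z. z \<in> S \<Longrightarrow> \<phi> z \<in> G_maps L (a + b)"
          "continuous_on (S \<times> {0..L}) (\<lambda>p. \<phi> (fst p) (snd p))"
      note s = crossing_props[OF A(1-3) \<phi>(1)]
      have c: "continuous_on (S \<times> {0..L}) (\<lambda>p. crossing L a (\<phi> (fst p)))"
        by (rule continuous_on_crossing_fst[OF A(1-3) \<phi>])
      have u': "continuous_on (S \<times> {0..L}) (\<lambda>p. \<upsilon> (fst p))"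
        by (rule continuous_on_compose2[OF u(2) continuous_on_fst[OF continuous_on_id]]) auto
      have "continuous_on (S \<times> {0..L}) (\<lambda>p. \<phi> (fst p) ((1 - \<upsilon> (fst p)) * snd p
          + \<upsilon> (fst p) * bend L (crossing L a (\<phi> (fst p))) (snd p)))"
      proof (rule continuous_on_family_compose[OF \<phi>(2)])
        fix p assume p: "p \<in> S \<times> {0..L}"
        let ?r = "\<lambda>t\<in>{0..L}. (1 - \<upsilon> (fst p)) * t + \<upsilon> (fst p) * bend L (crossing L a (\<phi> (fst p))) t"
        have "?r \<in> M_maps L L"
          using bend_G_maps[of "crossing L a (\<phi> (fst p))" L "\<upsilon> (fst p)"] s[of "fst p"] u(1)[of "fst p"] p A(1)
          by (auto simp: G_maps_iff)
        from M_mapsD(6,7)[OF A(1,1) this, of "snd p"] p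
        show "(1 - \<upsilon> (fst p)) * snd p + \<upsilon> (fst p) * bend L (crossing L a (\<phi> (fst p))) (snd p) \<in> {0..L}"
          by auto
      qed (use A(1) in \<open>auto simp: bend_def intro!: continuous_on_add continuous_on_diff continuous_on_mult continuous_on_divide
          continuous_on_min continuous_on_max continuous_on_const continuous_on_fst continuous_on_snd continuous_on_id c u'\<close>)
      then show "continuous_on (S \<times> {0..L}) (\<lambda>p. bend_path L a (\<upsilon> (fst p)) (\<phi> (fst p)) (snd p))"
        by (rule continuous_on_eq) (auto simp: bend_path_def compose_eq)
    qed (use A bend_path_G_maps in auto)
    fix \<psi> assume "\<psi> \<in> topspace (Hom G.P L (Tobj G.P a b))"
    then have \<psi>: "\<psi> \<in> G_maps L (a + b)"
      using A by (simp add: G.topspace_Hom)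
    then have "\<psi> \<in> extensional {0..L}"
      using A by (auto simp: G_maps_def)
    then show "(case (0, \<psi>) of (u, \<psi>) \<Rightarrow> bend_path L a u \<psi>) = \<psi>"
      by (intro extensionalityI[of _ "{0..L}"]) (auto simp: bend_path_def compose_eq)
    show "(case (1, \<psi>) of (u, \<psi>) \<Rightarrow> bend_path L a u \<psi>) =
        Comp G.P L (Tobj G.P L L) (Tobj G.P a b)
          (Tmor G.P L a L b (cut_left L a \<psi>) (cut_right L a \<psi>)) (\<lambda>t\<in>{0..L}. 2 * t)"
      using bend_path_1[OF A(1-3) \<psi>] by simp
  qed
  then show ?thesis
    unfolding has_cuts_def \<G>_def by blast
qed

theorem theorem7p2:
  fixes Top :: "(real \<Rightarrow> real) topology \<Rightarrow> bool"
  assumes "Top = delta_generated \<or> Top = (\<lambda>X. delta_generated X \<and> delta_Hausdorff X)"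
  shows "has_cuts Top \<G> \<and> has_cuts Top \<M>"
  using has_cuts_\<G>[OF assms] has_cuts_\<M>[OF assms] by blast

end
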